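(* Let $GP$ be the Grandparent graph and $h$ its layer height function. Let $\rho$ be the smallest positive root of the polynomial $$1-8x+10x^2-8x^3+8x^4$$ and let $\overline{\rho}$ be the smallest positive root of the polynomial $$1-4x+3x^2-x^3+x^4.$$ Then the bridge constant is $\beta(GP,h)=1/\rho$, the reversed bridge constant is $\overline{\beta}(GP,h)=1/\overline{\rho}$, and the connective constant is $$\mu(GP)=\max\{\beta(GP,h),\overline{\beta}(GP,h)\}=1/\rho$$ (numerically $\beta(GP,h)=\mu(GP)\approx 6.64993$ and $\overline{\beta}(GP,h)\approx 3.10380$).
   Context: Grandparent graph: let $T_3$ be the infinite 3-regular tree. An end of a tree is an equivalence class of one-way infinite self-avoiding walks, two being equivalent if they share all but finitely many initial vertices. Fix an end $\omega$ of $T_3$. For each vertex $v$ the predecessor $p(v)$ is the neighbour of $v$ following $v$ on the unique one-way infinite self-avoiding walk starting at $v$ that belongs to $\omega$; the other two neighbours of $v$ are its successors. The vertex set is the disjoint union of layers $H_k$, $k\in\mathbb{Z}$, such that $v\in H_k$ implies $p(v)\in H_{k-1}$ and the two successors of $v$ are in $H_{k+1}$. $GP$ is the graph on the vertex set of $T_3$ whose edges are the edges of $T_3$ together with all pairs $\{v,p(p(v))\}$. The layer height function is $h(v)=k$ for $v\in H_k$. $GP$ is transitive, and every automorphism of $GP$ fixes $\omega$ and preserves height differences. A walk of length $n\ge0$ starting at $v$ is a sequence of vertices $(v=v_0,\dots,v_n)$ with consecutive vertices adjacent; it is self-avoiding (a SAW) if no vertex occurs more than once. A SAW is a bridge if $h(v)<h(v_i)\le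 h(v_n)$ for all $1\le i\le n$, and a reversed bridge if $h(v)>h(v_i)\ge h(v_n)$ for all $1\le i\le n$ (the walk of length $0$ is both). Let $c_n$, $b_n$, $\overline{b}_n$ be the numbers of SAWs, bridges and reversed bridges of length $n$ in $GP$ starting at a given vertex (independent of the vertex). Then $\mu(GP)=\lim c_n^{1/n}$, $\beta(GP,h)=\lim b_n^{1/n}$, $\overline{\beta}(GP,h)=\lim\overline{b}_n^{1/n}$ (these limits exist). *)

theory Defs
  imports Complex_Main "HOL-Computational_Algebra.Polynomial"
begin

text \<open>
  A graph is its adjacency relation \<open>G :: 'v \<Rightarrow> 'v \<Rightarrow> bool\<close>; all elements of the type \<open>'v\<close> are vertices.
\<close>

definition simple_graph :: "('v \<Rightarrow> 'v \<Rightarrow> bool) \<Rightarrow> bool" where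
  "simple_graph G \<longleftrightarrow> symp G \<and> irreflp G"

definition is_cycle :: "('v \<Rightarrow> 'v \<Rightarrow> bool) \<Rightarrow> 'v list \<Rightarrow> bool" where
  "is_cycle G xs \<longleftrightarrow>
     3 \<le> length xs \<and> distinct xs \<and> successively G xs \<and> G (last xs) (hd xs)"

definition is_tree :: "('v \<Rightarrow> 'v \<Rightarrow> bool) \<Rightarrow> bool" where
  "is_tree G \<longleftrightarrow> simple_graph G \<and> (\<forall>u v. G\<^sup>*\<^sup>* u v) \<and> (\<nexists>xs. is_cycle G xs)"

definition regular_graph :: "nat \<Rightarrow> ('v \<Rightarrow> 'v \<Rightarrow> bool) \<Rightarrow> bool" where
  "regular_graph d G \<longleftrightarrow> (\<forall>v. finite {w. G v w} \<and> card {w. G v w} = d)"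


definition rays :: "('v \<Rightarrow> 'v \<Rightarrow> bool) \<Rightarrow> (nat \<Rightarrow> 'v) set" where
  "rays G = {r. inj r \<and> (\<forall>i. G (r i) (r (Suc i)))}"

definition ray_rel :: "('v \<Rightarrow> 'v \<Rightarrow> bool) \<Rightarrow> ((nat \<Rightarrow> 'v) \<times> (nat \<Rightarrow> 'v)) set" where
  "ray_rel G = {(r, s). r \<in> rays G \<and> s \<in> rays G \<and> (\<exists>m n. \<forall>i. r (m + i) = s (n + i))}"

definition ends_of :: "('v \<Rightarrow> 'v \<Rightarrow> bool) \<Rightarrow> (nat \<Rightarrow> 'v) set set" where
  "ends_of G = rays G // ray_rel G"

definition predecessor :: "(nat \<Rightarrow> 'v) set \<Rightarrow> 'v \<Rightarrow> 'v" where
  "predecessor \<omega> v = (THE r. r \<in> \<omega> \<and> r 0 = v) 1"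

definition successors :: "('v \<Rightarrow> 'v \<Rightarrow> bool) \<Rightarrow> (nat \<Rightarrow> 'v) set \<Rightarrow> 'v \<Rightarrow> 'v set" where
  "successors T \<omega> v = {w. T v w \<and> w \<noteq> predecessor \<omega> v}"

text \<open>The layer \<open>H\<^sub>k\<close> is \<open>{v. h v = k}\<close>; this determines \<open>h\<close> up to an additive constant.\<close>

definition layer_height ::
  "('v \<Rightarrow> 'v \<Rightarrow> bool) \<Rightarrow> (nat \<Rightarrow> 'v) set \<Rightarrow> ('v \<Rightarrow> int) \<Rightarrow> bool" where
  "layer_height T \<omega> h \<longleftrightarrow>
     (\<forall>v. h (predecessor \<omega> v) = h v - 1 \<and> (\<forall>w\<in>successors T \<omega> v. h w = h v + 1))"

definition grandparent_graph ::
  "('v \<Rightarrow> 'v \<Rightarrow> bool) \<Rightarrow> (nat \<Rightarrow> 'v) set \<Rightarrow> 'v \<Rightarrow> 'v \<Rightarrow> bool" where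
  "grandparent_graph T \<omega> u v \<longleftrightarrow>
     T u v
     \<or> v = predecessor \<omega> (predecessor \<omega> u)
     \<or> u = predecessor \<omega> (predecessor \<omega> v)"


definition saws :: "('v \<Rightarrow> 'v \<Rightarrow> bool) \<Rightarrow> 'v \<Rightarrow> nat \<Rightarrow> 'v list set" where
  "saws G v n = {xs. length xs = Suc n \<and> hd xs = v \<and> successively G xs \<and> distinct xs}"

definition bridges ::
  "('v \<Rightarrow> 'v \<Rightarrow> bool) \<Rightarrow> ('v \<Rightarrow> int) \<Rightarrow> 'v \<Rightarrow> nat \<Rightarrow> 'v list set" where
  "bridges G h v n =
     {xs \<in> saws G v n. \<forall>i\<in>{1..n}. h v < h (xs ! i) \<and> h (xs ! i) \<le> h (xs ! n)}"

definition rev_bridges ::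
  "('v \<Rightarrow> 'v \<Rightarrow> bool) \<Rightarrow> ('v \<Rightarrow> int) \<Rightarrow> 'v \<Rightarrow> nat \<Rightarrow> 'v list set" where
  "rev_bridges G h v n =
     {xs \<in> saws G v n. \<forall>i\<in>{1..n}. h v > h (xs ! i) \<and> h (xs ! i) \<ge> h (xs ! n)}"

definition growth_rate :: "(nat \<Rightarrow> nat) \<Rightarrow> real" where
  "growth_rate a = lim (\<lambda>n. root n (real (a n)))"

definition connective_constant :: "('v \<Rightarrow> 'v \<Rightarrow> bool) \<Rightarrow> 'v \<Rightarrow> real" where
  "connective_constant G v = growth_rate (\<lambda>n. card (saws G v n))"

definition bridge_constant :: "('v \<Rightarrow> 'v \<Rightarrow> bool) \<Rightarrow> ('v \<Rightarrow> int) \<Rightarrow> 'v \<Rightarrow> real" where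
  "bridge_constant G h v = growth_rate (\<lambda>n. card (bridges G h v n))"

definition rev_bridge_constant :: "('v \<Rightarrow> 'v \<Rightarrow> bool) \<Rightarrow> ('v \<Rightarrow> int) \<Rightarrow> 'v \<Rightarrow> real" where
  "rev_bridge_constant G h v = growth_rate (\<lambda>n. card (rev_bridges G h v n))"


definition smallest_pos_root :: "real poly \<Rightarrow> real" where
  "smallest_pos_root q = (LEAST x. 0 < x \<and> poly q x = 0)"

end

theory Submission
  imports Defs
begin

text \<open>
  The descendants of a vertex \<open>a\<close> form a rooted binary tree; a descendant in the \<open>k\<close>-th generation is
  encoded by a word of length \<open>k\<close> whose first letter is the most recent choice. Edges then join a
  word to its extensions by one or two letters at the front. The words ending in a fixed letter form
  a \<^emph>\<open>branch\<close>; once the root is removed, a walk cannot pass from one branch to the other. As a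
  self-avoiding walk sees the root only once, it has very few ways to interact with it, and this makes
  the counting problem finite.

  Give a walk of \<open>n\<close> steps that ends at depth \<open>k\<close> the weight \<open>x ^ n * y ^ k\<close>. Let \<open>D\<close> be the
  generating function of the self-avoiding walks of words from the root, \<open>A\<close> that of those from either
  of its two children. Deleting the root gives \<open>D = 1 + 2 x y (D + A)\<close>. A walk from a child either
  avoids the root, or reaches it along a \<^emph>\<open>hairpin\<close>, a path that goes down every second generation of a
  line and comes back through the others; there are \<open>2 ^ n\<close> hairpins with \<open>n\<close> steps. Following the walk
  beyond the root (\<open>child_saw_cases\<close>) gives
  \<open>A = 2 y D + 2 P + 2 P x y (D + A) + 4 x\<^sup>2 y\<^sup>2 (1 + P) D\<close> with \<open>P = x / (1 - 2 x)\<close>. This linear system is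
  singular exactly when \<open>renewal x y P = 1\<close>, which for \<open>y = 1\<close> and for \<open>y = 1/2\<close> says that \<open>x\<close> is a root
  of the first, respectively the second polynomial (\<open>renewal_full\<close>, \<open>renewal_half\<close>).

  Upper bounds: below the root of the polynomial the system bounds all partial sums of the
  generating function (\<open>weighted_count_le\<close>). Lower bounds: a walk all of whose hairpins have at
  most about \<open>M\<close> steps is never more than \<open>M\<close> generations deeper than its endpoint, so \<open>M + 1\<close> further
  steps down turn it into a bridge. The truncated system still grows at least like \<open>(1 / x) ^ n\<close>,
  for any \<open>x\<close> between the root of the polynomial and \<open>1/2\<close>, if \<open>M\<close> is large (\<open>peak_saws_ge\<close>).

  Bridges from \<open>v\<close> are walks of words that end at maximal depth, so they have \<open>y = 1\<close>. A self-avoiding walk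
  splits at its unique vertex of minimal height into two walks that descend from that vertex, so
  their number is at most a convolution square of the counts for \<open>y = 1\<close> and has the same growth rate
  as that of bridges (\<open>card_saws_le\<close>). A reversed bridge from \<open>v\<close>, read backwards, descends from an
  ancestor of \<open>v\<close> to the prescribed descendant \<open>v\<close>; by the symmetry of the binary tree this selects a
  fraction \<open>2 ^ (- k)\<close> of the walks that end at depth \<open>k\<close>, which is the weight \<open>y = 1/2\<close>
  (\<open>card_rev_bridges\<close>).
\<close>

section \<open>Walks of binary words\<close>

definition word_adj :: "bool list \<Rightarrow> bool list \<Rightarrow> bool" where
  "word_adj u w \<longleftrightarrow> (\<exists>b. w = b # u \<or> u = b # w) \<or> (\<exists>b c. w = b # c # u \<or> u = b # c # w)"

abbreviation below :: "bool list \<Rightarrow> bool list list \<Rightarrow> bool list list" where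
  "below e xs \<equiv> map (\<lambda>u. u @ e) xs"

definition word_saw :: "bool list list \<Rightarrow> bool" where
  "word_saw xs \<longleftrightarrow> xs \<noteq> [] \<and> successively word_adj xs \<and> distinct xs"

lemma word_adj_sym: "word_adj u w = word_adj w u"
  unfolding word_adj_def by blast

lemma word_adj_append [simp]: "word_adj (u @ e) (w @ e) = word_adj u w"
  unfolding word_adj_def by (simp del: append_Cons add: append_Cons [symmetric])

lemma word_adj_root: "word_adj [] w \<longleftrightarrow> (\<exists>u b. length u \<le> 1 \<and> w = u @ [b])"
proof
  assume "word_adj [] w"
  then consider b where "w = [b]" | b c where "w = [b, c]" by (auto simp: word_adj_def)
  then show "\<exists>u b. length u \<le> 1 \<and> w = u @ [b]"
    by cases (force, force)
next
  assume "\<exists>u b. length u \<le> 1 \<and> w = u @ [b]"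
  then show "word_adj [] w" by (auto simp: word_adj_def le_Suc_eq length_Suc_conv)
qed

lemma word_adj_root_append [simp]: "word_adj [] (u @ [b]) \<longleftrightarrow> length u \<le> 1"
  by (auto simp: word_adj_root)

lemma successively_below [simp]: "successively word_adj (below e xs) = successively word_adj xs"
  by (simp add: successively_map)

lemma distinct_below [simp]: "distinct (below e xs) = distinct xs"
  by (simp add: distinct_map inj_on_def)

lemma below_eq [simp]: "below e xs = below e ys \<longleftrightarrow> xs = ys"
  by (rule inj_map_eq_map) (simp add: inj_def)

lemma below_branch_eq:
  assumes "xs \<noteq> []"
  shows "below [b] xs = below [c] ys \<longleftrightarrow> b = c \<and> xs = ys"
proof
  assume eq: "below [b] xs = below [c] ys"
  with assms have "ys \<noteq> []" by auto
  with assms arg_cong [OF eq, of last] have "b = c" by (simp add: last_map)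
  with eq show "b = c \<and> xs = ys" by simp
qed simp

lemma word_saw_below [simp]: "word_saw (below e xs) = word_saw xs"
  by (simp add: word_saw_def)

lemma successively_rev_word: "successively word_adj (rev xs) = successively word_adj xs"
proof -
  have "(\<lambda>u w. word_adj w u) = word_adj" by (intro ext word_adj_sym)
  then show ?thesis unfolding successively_rev by (rule arg_cong)
qed

lemma word_saw_rev [simp]: "word_saw (rev xs) = word_saw xs"
  by (simp add: word_saw_def successively_rev_word del: successively_rev)

text \<open>
  An edge between two nonempty words preserves their last letter, since it only changes the front. So
  a walk that avoids the root is a walk of words, moved into one branch.
\<close>
lemma off_root_in_branch:
  assumes "successively word_adj xs" "[] \<notin> set xs" "xs \<noteq> []"
  shows "xs = below [last (hd xs)] (map butlast xs)"
proof -
  have "\<forall>u\<in>set xs. last u = last (hd xs)" using assms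
  proof (induction xs)
    case (Cons u xs)
    show ?case
    proof (cases xs)
      case Nil
      then show ?thesis by simp
    next
      case (Cons w ys)
      with Cons.prems have "word_adj u w" "u \<noteq> []" "w \<noteq> []" by auto
      then have "last u = last w" by (auto simp: word_adj_def)
      with Cons Cons.IH Cons.prems show ?thesis by simp
    qed
  qed simp
  then have "butlast u @ [last (hd xs)] = u" if "u \<in> set xs" for u
    using assms(2) that append_butlast_last_id [of u] by fastforce
  then show ?thesis by (simp add: map_idI)
qed

text \<open>
  Both the children and the grandchildren of the root become words of length at most 1 when the last
  letter is dropped: this is why walks from the root and walks from its children suffice.
\<close>
lemma word_saw_Cons_root:
  "word_saw ([] # t) \<longleftrightarrow>
     t = [] \<or> (\<exists>b z. t = below [b] z \<and> word_saw z \<and> length (hd z) \<le> 1)"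
proof (cases "t = []")
  case False
  show ?thesis
  proof
    assume saw: "word_saw ([] # t)"
    then have t: "successively word_adj t" "[] \<notin> set t" "distinct t"
      by (auto simp: word_saw_def successively_Cons)
    obtain b z where bz: "t = below [b] z"
      using off_root_in_branch [OF t(1,2) False] by blast
    have "word_adj [] (hd t)" using saw False by (simp add: word_saw_def successively_Cons)
    moreover have "hd t = hd z @ [b]" using False bz by (simp add: hd_map)
    ultimately have "length (hd z) \<le> 1" by simp
    moreover have "word_saw z" using bz t False by (simp add: word_saw_def)
    ultimately show "t = [] \<or> (\<exists>b z. t = below [b] z \<and> word_saw z \<and> length (hd z) \<le> 1)"
      using bz by blast
  next
    assume "t = [] \<or> (\<exists>b z. t = below [b] z \<and> word_saw z \<and> length (hd z) \<le> 1)"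
    then obtain b z where "t = below [b] z" "word_saw z" "length (hd z) \<le> 1"
      using False by blast
    then show "word_saw ([] # t)"
      by (auto simp: word_saw_def successively_Cons hd_map)
  qed
qed (simp add: word_saw_def)

lemma word_saw_root_below:
  "word_saw z \<Longrightarrow> length (hd z) \<le> 1 \<Longrightarrow> word_saw ([] # below [b] z)"
  unfolding word_saw_Cons_root by blast

section \<open>Hairpins\<close>

text \<open>
  The path visits the even generations of the line with letters \<open>cs\<close> on the way down and the odd
  ones on the way back, so that it ends at the child \<open>[hd cs]\<close> of the root (at the root itself if \<open>cs\<close>
  is empty). The reversal in the recursion exchanges the roles of even and odd.
\<close>
fun hairpin :: "bool list \<Rightarrow> bool list list" where
  "hairpin [] = [[]]"
| "hairpin (c # cs) = [] # below [c] (rev (hairpin cs))"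

lemma length_hairpin [simp]: "length (hairpin cs) = Suc (length cs)"
  by (induction cs) auto

lemma hairpin_nonempty [simp]: "hairpin cs \<noteq> []"
  by (cases cs) auto

lemma hd_hairpin [simp]: "hd (hairpin cs) = []"
  by (cases cs) auto

lemma last_hairpin [simp]: "last (hairpin cs) = take 1 cs"
  by (cases cs) (auto simp: last_map last_rev)

lemma word_saw_hairpin [simp]: "word_saw (hairpin cs)"
proof (induction cs)
  case (Cons c cs)
  then show ?case using word_saw_root_below [of "rev (hairpin cs)" c] by (simp add: hd_rev)
qed (simp add: word_saw_def)

lemma hairpin_depth: "u \<in> set (hairpin cs) \<Longrightarrow> length u \<le> length cs"
  by (induction cs arbitrary: u) auto

lemma hairpin_inj [simp]: "hairpin cs = hairpin ds \<longleftrightarrow> cs = ds"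
proof (induction cs arbitrary: ds)
  case Nil
  then show ?case by (cases ds) auto
next
  case (Cons c cs)
  then show ?case by (cases ds) (simp_all add: below_branch_eq)
qed

text \<open>
  In a branch, the vertices next to the parent of its top are the top and the children of the top. So
  these are all the paths along which a walk can leave a branch towards that parent. After its first
  step, such a path, reversed and seen from a child of the root, has the same property, which drives
  the induction.
\<close>
lemma hairpin_complete:
  assumes "word_saw y" "hd y = []" "length (last y) \<le> 1"
  shows "\<exists>cs. y = hairpin cs"
  using assms
proof (induction "length y" arbitrary: y)
  case (Suc n)
  obtain t where y: "y = [] # t"
    using Suc.prems by (metis list.exhaust_sel word_saw_def)
  show ?case
  proof (cases "t = []")
    case True
    then have "y = hairpin []" using y by simp
    then show ?thesis by blast
  next
    case False
    then obtain b z where z: "t = below [b] z" "word_saw z" "length (hd z) \<le> 1"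
      using Suc.prems y word_saw_Cons_root by blast
    with False y Suc.prems have "last z = []" by (simp add: last_map)
    with z False have "hd (rev z) = []" "length (last (rev z)) \<le> 1" "word_saw (rev z)"
      by (auto simp: hd_rev last_rev)
    moreover have "n = length (rev z)" using Suc.hyps y z by simp
    ultimately obtain cs where "rev z = hairpin cs" using Suc.hyps by blast
    then have "z = rev (hairpin cs)" by (metis rev_rev_ident)
    then have "y = hairpin (b # cs)" using y z by simp
    then show ?thesis by blast
  qed
qed (simp add: word_saw_def)

section \<open>Decomposition of a walk at the root\<close>

lemma word_saw_until_root:
  assumes "word_saw (pre @ [] # suf)" "pre \<noteq> []" and a: "hd pre = [a]"
  obtains cs where "pre = below [a] (hairpin cs)" "word_saw ([] # suf)"
proof -
  have pre: "successively word_adj pre" "[] \<notin> set pre" "distinct pre"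
    and adj: "word_adj (last pre) []" and suf: "word_saw ([] # suf)"
    using assms by (auto simp: word_saw_def successively_append_iff)
  define y where "y = map butlast pre"
  have y: "pre = below [a] y"
    using off_root_in_branch [OF pre(1,2) assms(2)] a by (simp add: y_def)
  have "word_saw y" using pre assms(2) y by (simp add: word_saw_def)
  moreover have "hd y = []" using y a assms(2) by (simp add: hd_map)
  moreover have "word_adj [] (last y @ [a])"
    using adj y assms(2) word_adj_sym by (simp add: last_map)
  then have "length (last y) \<le> 1" by simp
  ultimately obtain cs where "y = hairpin cs" using hairpin_complete by blast
  with y suf that show ?thesis by blast
qed

text \<open>
  A walk that climbs to the root out of the branch \<open>a\<close> along a hairpin and then follows \<open>z\<close> in the
  branch \<open>b\<close>.
\<close>
abbreviation turn :: "bool \<Rightarrow> bool list \<Rightarrow> bool \<Rightarrow> bool list list \<Rightarrow> bool list list" where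
  "turn a cs b z \<equiv> below [a] (hairpin cs) @ [] # below [b] z"

text \<open>
  After the root, the walk may enter the other branch freely. If it turns back into the branch \<open>a\<close>, it
  has to avoid the hairpin: the vertex \<open>[a]\<close> is taken, so it enters at a grandchild \<open>[c, a]\<close> of the root and
  stays below it, and unless the hairpin is the single vertex \<open>[a]\<close>, one of the two grandchildren in that
  branch is its endpoint and also taken.
\<close>
lemma child_saw_cases:
  assumes saw: "word_saw xs" and hd: "hd xs = [a]"
  obtains (stay) d where "xs = below [a] d" "word_saw d" "hd d = []"
  | (stop) cs where "xs = below [a] (hairpin cs) @ [[]]"
  | (cross) cs z where "xs = turn a cs (\<not> a) z" "word_saw z" "length (hd z) \<le> 1"
  | (return) c d where "xs = turn a [] a (below [c] d)" "word_saw d" "hd d = []"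
  | (return_hairpin) c cs d where "xs = turn a (c # cs) a (below [\<not> c] d)"
      "word_saw d" "hd d = []"
proof (cases "[] \<in> set xs")
  case False
  define d where "d = map butlast xs"
  have ne: "xs \<noteq> []" using saw by (simp add: word_saw_def)
  have "xs = below [a] d"
    using off_root_in_branch [of xs] saw False hd by (simp add: word_saw_def d_def)
  moreover have "word_saw d" "hd d = []"
    using saw calculation hd ne by (auto simp: hd_map)
  ultimately show ?thesis using stay by blast
next
  case True
  then obtain pre suf where xs: "xs = pre @ [] # suf" by (meson split_list)
  have ne: "pre \<noteq> []" using hd xs by auto
  have hd': "hd pre = [a]" using hd xs ne by simp
  obtain cs where pre: "pre = below [a] (hairpin cs)" and suf: "word_saw ([] # suf)"
    using word_saw_until_root [OF saw [unfolded xs] ne hd'] by blast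
  show ?thesis
  proof (cases "suf = []")
    case True
    then show ?thesis using stop xs pre by simp
  next
    case False
    then obtain b z where z: "suf = below [b] z" "word_saw z" "length (hd z) \<le> 1"
      using suf word_saw_Cons_root by blast
    show ?thesis
    proof (cases "b = a")
      case False
      then have "b = (\<not> a)" by auto
      then show ?thesis using cross xs pre z by blast
    next
      case True
      have disj: "set (hairpin cs) \<inter> set z = {}"
        using saw xs pre z True by (auto simp: word_saw_def)
      have zne: "z \<noteq> []" and zs: "successively word_adj z" using z by (auto simp: word_saw_def)
      have "[] \<in> set (hairpin cs)"
        by (metis hairpin_nonempty hd_hairpin list.set_sel(1))
      then have znr: "[] \<notin> set z" using disj by auto
      then have "hd z \<noteq> []" using zne by (metis list.set_sel(1))
      then obtain b' where b': "hd z = [b']" using z(3) by (auto simp: le_Suc_eq length_Suc_conv)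
      define d where "d = map butlast z"
      have d: "z = below [b'] d" using off_root_in_branch [OF zs znr zne] b' by (simp add: d_def)
      then have d': "word_saw d" "hd d = []" using z b' zne by (auto simp: hd_map)
      show ?thesis
      proof (cases cs)
        case Nil
        then show ?thesis using return [of b' d] xs pre z d d' True by simp
      next
        case (Cons c cs')
        have "[c] \<in> set (hairpin cs)"
          using last_in_set [OF hairpin_nonempty, of cs] unfolding last_hairpin Cons by simp
        then have "b' \<noteq> c" using disj b' hd_in_set [OF zne] by auto
        then have "b' = (\<not> c)" by auto
        then show ?thesis using return_hairpin [of c cs' d] xs pre z d d' True Cons by simp
      qed
    qed
  qed
qed

section \<open>Upper bounds from the decomposition\<close>

definition root_saws :: "nat \<Rightarrow> bool list list set" where
  "root_saws N = {xs. word_saw xs \<and> hd xs = [] \<and> length xs \<le> N}"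

definition child_saws :: "nat \<Rightarrow> bool list list set" where
  "child_saws N = {xs. word_saw xs \<and> length (hd xs) = 1 \<and> length xs \<le> N}"

definition weight :: "real \<Rightarrow> real \<Rightarrow> bool list list \<Rightarrow> real" where
  "weight x y xs = x ^ (length xs - 1) * y ^ length (last xs)"

lemma successively_depth:
  "successively word_adj xs \<Longrightarrow> u \<in> set xs \<Longrightarrow> length u \<le> length (hd xs) + 2 * length xs"
proof (induction xs)
  case (Cons w xs)
  show ?case
  proof (cases "u = w")
    case False
    then have "u \<in> set xs" "xs \<noteq> []" using Cons.prems by auto
    then have "length u \<le> length (hd xs) + 2 * length xs" "word_adj w (hd xs)"
      using Cons by (auto simp: successively_Cons)
    moreover have "length (hd xs) \<le> length w + 2" using \<open>word_adj w (hd xs)\<close>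
      by (auto simp: word_adj_def)
    ultimately show ?thesis by simp
  qed simp
qed simp

lemma finite_short_saws:
  "finite {xs. word_saw xs \<and> length (hd xs) \<le> k \<and> length xs \<le> N}"
proof (rule finite_subset)
  let ?U = "{u :: bool list. length u \<le> k + 2 * N}"
  show "{xs. word_saw xs \<and> length (hd xs) \<le> k \<and> length xs \<le> N} \<subseteq> {xs. set xs \<subseteq> ?U \<and> length xs \<le> N}"
    using successively_depth by (fastforce simp: word_saw_def)
  have "finite ?U" using finite_lists_length_le [of "UNIV :: bool set"] by simp
  then show "finite {xs. set xs \<subseteq> ?U \<and> length xs \<le> N}" by (rule finite_lists_length_le)
qed

lemma finite_root_saws [simp]: "finite (root_saws N)"
  by (rule finite_subset [OF _ finite_short_saws [of 0 N]]) (auto simp: root_saws_def)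

lemma finite_child_saws [simp]: "finite (child_saws N)"
  by (rule finite_subset [OF _ finite_short_saws [of 1 N]]) (auto simp: child_saws_def)

lemma weight_below: "xs \<noteq> [] \<Longrightarrow> weight x y (below e xs) = y ^ length e * weight x y xs"
  by (simp add: weight_def last_map power_add)

lemma weight_append: "xs \<noteq> [] \<Longrightarrow> weight x y (p @ xs) = x ^ length p * weight x y xs"
  by (cases xs) (simp_all add: weight_def power_add)

lemma weight_Cons: "xs \<noteq> [] \<Longrightarrow> weight x y (u # xs) = x * weight x y xs"
  using weight_append [of xs x y "[u]"] by simp

lemma sum_image_product_le:
  fixes w :: "'c \<Rightarrow> real"
  assumes "finite A" "finite B" and nonneg: "\<And>c. w c \<ge> 0"
    and "\<And>a b. a \<in> A \<Longrightarrow> b \<in> B \<Longrightarrow> w (f (a, b)) = u a * v b"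
  shows "sum w (f ` (A \<times> B)) \<le> sum u A * sum v B"
proof -
  have "sum w (f ` (A \<times> B)) \<le> (\<Sum>p\<in>A \<times> B. w (f p))"
    using sum_image_le [of "A \<times> B" w f] assms(1,2) nonneg by (simp add: o_def)
  also have "\<dots> = (\<Sum>a\<in>A. \<Sum>b\<in>B. w (f (a, b)))"
    by (simp add: sum.cartesian_product)
  also have "\<dots> = sum u A * sum v B"
    using assms(4) by (simp add: sum_product)
  finally show ?thesis .
qed

lemma sum_Un_le:
  fixes w :: "'c \<Rightarrow> real"
  assumes "finite A" "finite B" "\<And>c. w c \<ge> 0"
  shows "sum w (A \<union> B) \<le> sum w A + sum w B"
  using sum.union_inter [OF assms(1,2), of w] sum_nonneg [of "A \<inter> B" w] assms(3) by simp

lemma root_saws_subset: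
  "root_saws N \<subseteq> {[[]]} \<union> (\<lambda>(b, z). [] # below [b] z) ` (UNIV \<times> (root_saws N \<union> child_saws N))"
proof
  fix xs assume "xs \<in> root_saws N"
  then have xs: "word_saw xs" "hd xs = []" "length xs \<le> N" by (auto simp: root_saws_def)
  then obtain t where t: "xs = [] # t" by (metis list.exhaust_sel word_saw_def)
  with xs(1) consider "t = []" | b z where "t = below [b] z" "word_saw z" "length (hd z) \<le> 1"
    using word_saw_Cons_root by blast
  then show "xs \<in> {[[]]} \<union> (\<lambda>(b, z). [] # below [b] z) ` (UNIV \<times> (root_saws N \<union> child_saws N))"
  proof cases
    case 2
    then have "z \<in> root_saws N \<union> child_saws N"
      using xs t by (auto simp: root_saws_def child_saws_def le_Suc_eq)
    then show ?thesis using t 2 by auto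
  qed (simp add: t)
qed

lemma child_saws_subset:
  fixes N defines "C \<equiv> {cs :: bool list. length cs \<le> N}"
  shows "child_saws N \<subseteq> (\<lambda>(a, d). below [a] d) ` (UNIV \<times> root_saws N)
    \<union> (\<lambda>(a, cs). below [a] (hairpin cs) @ [[]]) ` (UNIV \<times> C)
    \<union> (\<lambda>((a, cs), z). turn a cs (\<not> a) z)
        ` ((UNIV \<times> C) \<times> (root_saws N \<union> child_saws N))
    \<union> (\<lambda>((a, c), d). turn a [] a (below [c] d)) ` ((UNIV \<times> UNIV) \<times> root_saws N)
    \<union> (\<lambda>((a, c, cs), d). turn a (c # cs) a (below [\<not> c] d))
        ` ((UNIV \<times> UNIV \<times> C) \<times> root_saws N)"
    (is "_ \<subseteq> ?R")
proof
  fix xs assume "xs \<in> child_saws N"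
  then obtain a where xs: "word_saw xs" "hd xs = [a]" "length xs \<le> N"
    by (auto simp: child_saws_def length_Suc_conv)
  from xs(1,2) show "xs \<in> ?R"
  proof (cases rule: child_saw_cases)
    case (stay d)
    then have "d \<in> root_saws N" using xs by (simp add: root_saws_def)
    then show ?thesis using stay by auto
  next
    case (stop cs)
    then have "cs \<in> C" using xs by (simp add: C_def)
    then show ?thesis using stop by auto
  next
    case (cross cs z)
    then have "cs \<in> C" using xs by (simp add: C_def)
    moreover have "z \<in> root_saws N \<union> child_saws N"
      using xs cross by (auto simp: root_saws_def child_saws_def le_Suc_eq)
    ultimately have "xs \<in> (\<lambda>((a, cs), z). turn a cs (\<not> a) z)
        ` ((UNIV \<times> C) \<times> (root_saws N \<union> child_saws N))"
      using cross by (intro image_eqI [of _ _ "((a, cs), z)"]) auto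
    then show ?thesis by blast
  next
    case (return c d)
    then have "d \<in> root_saws N" using xs by (simp add: root_saws_def)
    then have "xs \<in> (\<lambda>((a, c), d). turn a [] a (below [c] d)) ` ((UNIV \<times> UNIV) \<times> root_saws N)"
      using return by (intro image_eqI [of _ _ "((a, c), d)"]) auto
    then show ?thesis by blast
  next
    case (return_hairpin c cs d)
    then have "d \<in> root_saws N" "cs \<in> C" using xs by (auto simp: root_saws_def C_def)
    then have "xs \<in> (\<lambda>((a, c, cs), d). turn a (c # cs) a (below [\<not> c] d))
        ` ((UNIV \<times> UNIV \<times> C) \<times> root_saws N)"
      using return_hairpin by (intro image_eqI [of _ _ "((a, c, cs), d)"]) auto
    then show ?thesis by blast
  qed
qed

lemma weight_nonneg: "0 \<le> x \<Longrightarrow> 0 \<le> y \<Longrightarrow> 0 \<le> weight x y xs"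
  by (simp add: weight_def)

lemma weight_root: "weight x y [[]] = 1"
  by (simp add: weight_def)

lemma card_bool_lists: "card {cs :: bool list. length cs = n} = 2 ^ n"
  using card_lists_length_eq [of "UNIV :: bool set" n] by simp

lemma finite_bool_lists_le [simp]: "finite {cs :: bool list. length cs \<le> N}"
  using finite_lists_length_le [of "UNIV :: bool set" N] by simp

lemma sum_bool_lists:
  fixes x :: real
  shows "(\<Sum>cs\<in>{cs :: bool list. length cs \<le> N}. x ^ length cs) = (\<Sum>i\<le>N. (2 * x) ^ i)"
proof -
  let ?C = "{cs :: bool list. length cs \<le> N}"
  have "(\<Sum>cs\<in>?C. x ^ length cs) = (\<Sum>i\<le>N. \<Sum>cs\<in>{cs \<in> ?C. length cs = i}. x ^ length cs)"
    by (rule sum.group [symmetric]) auto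
  also have "\<dots> = (\<Sum>i\<le>N. (2 * x) ^ i)"
  proof (rule sum.cong [OF refl])
    fix i assume "i \<in> {..N}"
    then have "{cs \<in> ?C. length cs = i} = {cs. length cs = i}" by auto
    then show "(\<Sum>cs\<in>{cs \<in> ?C. length cs = i}. x ^ length cs) = (2 * x) ^ i"
      by (simp add: card_bool_lists power_mult_distrib)
  qed
  finally show ?thesis .
qed

lemma sum_bool_lists_le:
  fixes x :: real
  assumes "0 \<le> x" "x < 1/2"
  shows "(\<Sum>cs\<in>{cs :: bool list. length cs \<le> N}. x ^ length cs) \<le> 1 / (1 - 2 * x)"
proof -
  have "(1 - 2 * x) * (\<Sum>i\<le>N. (2 * x) ^ i) = 1 - (2 * x) ^ Suc N" by (rule sum_gp_basic)
  also have "\<dots> \<le> 1" using assms by simp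
  finally show ?thesis using assms by (simp add: sum_bool_lists field_simps)
qed

lemma root_saws_weight_le:
  assumes "0 \<le> x" "0 \<le> y"
  shows "sum (weight x y) (root_saws N) \<le> 1 + 2 * x * y * sum (weight x y) (root_saws N \<union> child_saws N)"
proof -
  let ?Z = "root_saws N \<union> child_saws N"
  note nonneg = weight_nonneg [OF assms]
  have ne: "z \<noteq> []" if "z \<in> ?Z" for z
    using that by (auto simp: root_saws_def child_saws_def word_saw_def)
  have "sum (weight x y) (root_saws N)
      \<le> sum (weight x y) ({[[]]} \<union> (\<lambda>(b, z). [] # below [b] z) ` (UNIV \<times> ?Z))"
    by (intro sum_mono2 root_saws_subset nonneg) simp
  also have "\<dots> \<le> weight x y [[]] + sum (weight x y) ((\<lambda>(b, z). [] # below [b] z) ` (UNIV \<times> ?Z))"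
    using sum_Un_le [of "{[[]]}" _ "weight x y"] nonneg by simp
  also have "sum (weight x y) ((\<lambda>(b, z). [] # below [b] z) ` (UNIV \<times> ?Z))
      \<le> sum (\<lambda>b :: bool. x * y) UNIV * sum (weight x y) ?Z"
    by (rule sum_image_product_le) (auto simp: nonneg weight_Cons weight_below ne)
  finally show ?thesis by (simp add: weight_def)
qed

lemma child_saws_weight_le:
  fixes N defines "C \<equiv> {cs :: bool list. length cs \<le> N}"
  assumes "0 \<le> x" "0 \<le> y"
  defines "g \<equiv> (\<Sum>cs\<in>C. x ^ length cs)"
  shows "sum (weight x y) (child_saws N) \<le>
      (2 * y + 4 * x^2 * y^2 + 4 * x^3 * y^2 * g) * sum (weight x y) (root_saws N)
      + 2 * x * g + 2 * x^2 * y * g * sum (weight x y) (root_saws N \<union> child_saws N)"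
proof -
  let ?D = "root_saws N" and ?Z = "root_saws N \<union> child_saws N"
  let ?S = "sum (weight x y)"
  note nonneg = weight_nonneg [OF assms(2,3)]
  have ne: "z \<noteq> []" if "z \<in> ?Z" for z
    using that by (auto simp: root_saws_def child_saws_def word_saw_def)
  have neD: "d \<noteq> []" if "d \<in> ?D" for d using that ne by blast
  have C: "finite C" by (simp add: C_def)
  have s2: "sum (\<lambda>cs. x * x ^ length cs) C = x * g"
    by (simp add: g_def sum_distrib_left)
  have s3: "sum (\<lambda>(a :: bool, cs). x^2 * y * x ^ length cs) (UNIV \<times> C) = 2 * x^2 * y * g"
    by (simp add: sum.cartesian_product [symmetric] g_def sum_distrib_left mult.assoc)
  have s4: "sum (\<lambda>(a :: bool, c :: bool). x^2 * y^2) (UNIV \<times> UNIV) = 4 * x^2 * y^2"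
    by (simp add: sum.cartesian_product [symmetric] del: UNIV_Times_UNIV)
  have s5: "sum (\<lambda>(a :: bool, c :: bool, cs). x^3 * y^2 * x ^ length cs) (UNIV \<times> UNIV \<times> C)
      = 4 * x^3 * y^2 * g"
    by (simp add: sum.cartesian_product [symmetric] g_def sum_distrib_left mult.assoc)
  let ?I1 = "(\<lambda>(a, d). below [a] d) ` (UNIV \<times> ?D)"
  let ?I2 = "(\<lambda>(a, cs). below [a] (hairpin cs) @ [[]]) ` (UNIV \<times> C)"
  let ?I3 = "(\<lambda>((a, cs), z). turn a cs (\<not> a) z) ` ((UNIV \<times> C) \<times> ?Z)"
  let ?I4 = "(\<lambda>((a, c), d). turn a [] a (below [c] d)) ` ((UNIV \<times> UNIV) \<times> ?D)"
  let ?I5 = "(\<lambda>((a, c, cs), d). turn a (c # cs) a (below [\<not> c] d))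
        ` ((UNIV \<times> UNIV \<times> C) \<times> ?D)"
  have 1: "?S ?I1 \<le> sum (\<lambda>a :: bool. y) UNIV * ?S ?D"
    by (rule sum_image_product_le) (auto simp: nonneg weight_below neD)
  have 2: "?S ?I2 \<le> sum (\<lambda>a :: bool. 1) UNIV * sum (\<lambda>cs. x * x ^ length cs) C"
    by (rule sum_image_product_le) (auto simp: nonneg weight_append weight_root C)
  have 3: "?S ?I3 \<le> sum (\<lambda>(a :: bool, cs). x^2 * y * x ^ length cs) (UNIV \<times> C) * ?S ?Z"
    by (rule sum_image_product_le)
      (auto simp: nonneg weight_append weight_Cons weight_below ne C power2_eq_square)
  have 4: "?S ?I4 \<le> sum (\<lambda>(a :: bool, c :: bool). x^2 * y^2) (UNIV \<times> UNIV) * ?S ?D"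
    by (rule sum_image_product_le)
      (auto simp: nonneg weight_append weight_Cons weight_below neD power2_eq_square simp del: map_map)
  have 5: "?S ?I5 \<le> sum (\<lambda>(a :: bool, c :: bool, cs). x^3 * y^2 * x ^ length cs) (UNIV \<times> UNIV \<times> C) * ?S ?D"
    by (rule sum_image_product_le)
      (auto simp: nonneg weight_append weight_Cons weight_below neD C power2_eq_square power3_eq_cube simp del: hairpin.simps map_map)
  have fin: "finite ?I1" "finite ?I2" "finite ?I3" "finite ?I4" "finite ?I5"
    by (intro finite_imageI finite_cartesian_product; simp add: C)+
  have "?S (child_saws N) \<le> ?S (?I1 \<union> ?I2 \<union> ?I3 \<union> ?I4 \<union> ?I5)"
    by (intro sum_mono2 child_saws_subset [of N, folded C_def] nonneg finite_UnI fin)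
  also have "\<dots> \<le> ?S ?I1 + ?S ?I2 + ?S ?I3 + ?S ?I4 + ?S ?I5"
    by (intro order_trans [OF sum_Un_le] add_mono order_refl finite_UnI fin nonneg)
  also have "\<dots> \<le> sum (\<lambda>a :: bool. y) UNIV * ?S ?D
      + sum (\<lambda>a :: bool. 1) UNIV * sum (\<lambda>cs. x * x ^ length cs) C
      + sum (\<lambda>(a :: bool, cs). x^2 * y * x ^ length cs) (UNIV \<times> C) * ?S ?Z
      + sum (\<lambda>(a :: bool, c :: bool). x^2 * y^2) (UNIV \<times> UNIV) * ?S ?D
      + sum (\<lambda>(a :: bool, c :: bool, cs). x^3 * y^2 * x ^ length cs) (UNIV \<times> UNIV \<times> C) * ?S ?D"
    by (intro add_mono 1 2 3 4 5)
  also have "\<dots> = (2 * y + 4 * x^2 * y^2 + 4 * x^3 * y^2 * g) * ?S ?D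
      + 2 * x * g + 2 * x^2 * y * g * ?S ?Z"
    unfolding s2 s3 s4 s5 by (simp add: algebra_simps)
  finally show ?thesis .
qed

text \<open>
  If \<open>s\<close> is the total weight of the hairpins together with the step to the root, then the sum of the
  weights of both kinds of walks is bounded by a constant plus \<open>renewal x y s\<close> times itself. The
  factor \<open>2 x y\<close> is the step from the root; the terms in the bracket are the ways of
  coming back to a state where the rest of the walk is arbitrary.
\<close>
definition renewal :: "real \<Rightarrow> real \<Rightarrow> real \<Rightarrow> real" where
  "renewal x y s = 2 * x * y * (1 + 2 * y + 4 * x^2 * y^2 + (1 + 4 * x^2 * y^2) * s)"

text \<open>
  Truncation at length \<open>N\<close> keeps all sums finite, and as pieces of a walk are shorter than the walk, the
  inequalities hold with the same \<open>N\<close> on both sides. They can therefore be solved for \<open>Z\<close>, with a bound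
  that does not depend on \<open>N\<close>.
\<close>
lemma root_saws_weight_bounded:
  fixes x y :: real
  assumes x: "0 < x" "x < 1/2" and y: "0 < y"
    and sub: "renewal x y (x / (1 - 2 * x)) < 1"
  obtains K where "K > 0" "\<And>N. sum (weight x y) (root_saws N) \<le> K"
proof -
  define \<pi> where "\<pi> = x / (1 - 2 * x)"
  have \<pi>: "\<pi> > 0" using x by (simp add: \<pi>_def)
  define \<kappa> where "\<kappa> = 1 + 2 * y + 4 * x^2 * y^2 + 4 * x^2 * y^2 * \<pi>"
  define \<theta> where "\<theta> = 2 * x * y * (\<kappa> + \<pi>)"
  have \<theta>: "\<theta> < 1" using sub unfolding \<pi>_def [symmetric] by (simp add: renewal_def \<theta>_def \<kappa>_def algebra_simps)
  have \<kappa>: "\<kappa> \<ge> 0" using x y \<pi> by (simp add: \<kappa>_def)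
  have "sum (weight x y) (root_saws N) \<le> (\<kappa> + 2 * \<pi>) / (1 - \<theta>)" for N
  proof -
    define D where "D = sum (weight x y) (root_saws N)"
    define A where "A = sum (weight x y) (child_saws N)"
    define Z where "Z = sum (weight x y) (root_saws N \<union> child_saws N)"
    define g where "g = (\<Sum>cs\<in>{cs :: bool list. length cs \<le> N}. x ^ length cs)"
    have nonneg: "weight x y c \<ge> 0" for c using x y by (simp add: weight_nonneg)
    have D0: "D \<ge> 0" and Z0: "Z \<ge> 0" unfolding D_def Z_def by (auto intro!: sum_nonneg nonneg)
    have "x * g \<le> x * (1 / (1 - 2 * x))"
      unfolding g_def using x by (intro mult_left_mono sum_bool_lists_le) auto
    then have g: "x * g \<le> \<pi>" by (simp add: \<pi>_def)
    have DZ: "D \<le> Z" unfolding D_def Z_def by (intro sum_mono2 nonneg) auto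
    have "Z \<le> D + A" unfolding D_def Z_def A_def by (intro sum_Un_le nonneg) auto
    also have "A \<le> (2 * y + 4 * x^2 * y^2 + 4 * x^3 * y^2 * g) * D + 2 * x * g + 2 * x^2 * y * g * Z"
      unfolding A_def D_def Z_def g_def using x y by (intro child_saws_weight_le) auto
    also have "\<dots> = (2 * y + 4 * x^2 * y^2 + 4 * x^2 * y^2 * (x * g)) * D + 2 * (x * g) + 2 * x * y * (x * g) * Z"
      by (simp add: power2_eq_square power3_eq_cube)
    also have "\<dots> \<le> (2 * y + 4 * x^2 * y^2 + 4 * x^2 * y^2 * \<pi>) * D + 2 * \<pi> + 2 * x * y * \<pi> * Z"
      using x y D0 Z0 g by (intro add_mono mult_right_mono mult_left_mono) auto
    finally have "Z \<le> \<kappa> * D + 2 * \<pi> + 2 * x * y * \<pi> * Z"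
      by (simp add: \<kappa>_def algebra_simps)
    also have "\<kappa> * D \<le> \<kappa> * (1 + 2 * x * y * Z)"
      using root_saws_weight_le [of x y N] x y \<kappa> unfolding D_def Z_def
      by (intro mult_left_mono) auto
    finally have "(1 - \<theta>) * Z \<le> \<kappa> + 2 * \<pi>" by (simp add: \<theta>_def algebra_simps)
    then have "Z \<le> (\<kappa> + 2 * \<pi>) / (1 - \<theta>)" using \<theta> by (simp add: field_simps)
    with DZ show ?thesis by (simp add: D_def)
  qed
  moreover have "(\<kappa> + 2 * \<pi>) / (1 - \<theta>) > 0" using \<theta> \<kappa> \<pi> by simp
  ultimately show ?thesis using that by blast
qed

lemma weighted_count_le:
  fixes x y :: real
  assumes x: "0 < x" "x < 1/2" and y: "0 < y"
    and sub: "renewal x y (x / (1 - 2 * x)) < 1"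
  obtains K where "K > 0" "\<And>n. (\<Sum>xs\<in>saws word_adj [] n. y ^ length (last xs)) \<le> K * (1 / x) ^ n"
proof -
  obtain K where K: "K > 0" "\<And>N. sum (weight x y) (root_saws N) \<le> K"
    using root_saws_weight_bounded [OF assms] by metis
  have "(\<Sum>xs\<in>saws word_adj [] n. y ^ length (last xs)) \<le> K * (1 / x) ^ n" for n
  proof -
    have sub: "saws word_adj [] n \<subseteq> root_saws (Suc n)"
      by (auto simp: saws_def root_saws_def word_saw_def)
    have "x ^ n * (\<Sum>xs\<in>saws word_adj [] n. y ^ length (last xs)) = sum (weight x y) (saws word_adj [] n)"
      unfolding sum_distrib_left by (rule sum.cong) (auto simp: weight_def saws_def)
    also have "\<dots> \<le> sum (weight x y) (root_saws (Suc n))"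
      using sub x y by (intro sum_mono2 weight_nonneg) auto
    also have "\<dots> \<le> K" by (rule K)
    finally show ?thesis using x by (simp add: field_simps power_one_over)
  qed
  with K(1) that show ?thesis by blast
qed

section \<open>Walks that can be extended to bridges\<close>

text \<open>
  The root occurs only once, so all data of such a walk can be read off from it; the families of walks
  that are counted in the lower bound are therefore disjoint.
\<close>
lemma turn_eq_iff:
  assumes "z \<noteq> []" "z' \<noteq> []"
  shows "turn a cs b z = turn a' cs' b' z' \<longleftrightarrow> a = a' \<and> cs = cs' \<and> b = b' \<and> z = z'"
proof -
  have "turn a cs b z = turn a' cs' b' z' \<longleftrightarrow>
      below [a] (hairpin cs) = below [a'] (hairpin cs') \<and> below [b] z = below [b'] z'"
    by (rule append_Cons_eq_iff) auto
  then show ?thesis using assms by (simp add: below_branch_eq)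
qed

lemma word_saw_append:
  assumes "word_saw p" "word_saw z" "word_adj (last p) (hd z @ e)" "\<forall>u\<in>set p. \<nexists>w. u = w @ e"
  shows "word_saw (p @ below e z)"
  using assms by (auto simp: word_saw_def successively_append_iff hd_map)

text \<open>
  The first condition keeps the subtree of the endpoint fresh, so that any walk can be attached there.
  The second one makes \<open>M + 1\<close> steps down from the endpoint lead below everything visited before.
\<close>
definition tame :: "nat \<Rightarrow> bool list list \<Rightarrow> bool" where
  "tame M xs \<longleftrightarrow> (\<forall>u\<in>set (butlast xs). \<nexists>w. u = w @ last xs)
     \<and> (\<forall>u\<in>set xs. length u \<le> length (last xs) + M)"

lemma tame_append:
  assumes "tame M z" "z \<noteq> []" "\<forall>u\<in>set p. (\<nexists>w. u = w @ e) \<and> length u \<le> length e + M"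
  shows "tame M (p @ below e z)"
proof -
  have butlast: "butlast (p @ below e z) = p @ below e (butlast z)"
    and last: "last (p @ below e z) = last z @ e"
    using assms(2) by (simp_all add: butlast_append map_butlast last_map)
  have "\<nexists>w. u = w @ last z @ e" if "u \<in> set p" for u
    using assms(3) that by (metis append_assoc)
  moreover have "\<nexists>w. v @ e = w @ last z @ e" if "v \<in> set (butlast z)" for v
  proof -
    have "v @ e = w @ last z @ e \<longleftrightarrow> v = w @ last z" for w
      by (metis append_assoc append_same_eq)
    then show ?thesis using assms(1) that by (auto simp: tame_def)
  qed
  ultimately show ?thesis
    unfolding tame_def butlast last using assms(1,3) by (fastforce simp: tame_def)
qed

lemma hairpin_suffix:
  assumes "u \<in> set (hairpin (c # cs))"
  shows "u = [] \<or> last u = c"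
  using assms by auto

text \<open>
  A hairpin followed by the step to the root is itself a hairpin, read backwards.
\<close>
lemma turn_eq_rev_hairpin: "turn a cs b z = rev (hairpin (a # cs)) @ below [b] z"
  by (simp add: rev_map)

lemma hairpin_depth_Cons:
  "u \<in> set (hairpin (c # cs)) \<Longrightarrow> length u \<le> Suc (length cs)"
  using hairpin_depth [of u "c # cs"] by simp

lemma turn_away:
  assumes "word_saw z" "length (hd z) \<le> 1" "tame M z" "length cs \<le> M"
  shows "word_saw (turn a cs (\<not> a) z)" "tame M (turn a cs (\<not> a) z)"
proof -
  have z: "z \<noteq> []" using assms by (simp add: word_saw_def)
  have avoid: "\<forall>u\<in>set (rev (hairpin (a # cs))). \<nexists>w. u = w @ [\<not> a]"
  proof (intro ballI notI; elim exE)
    fix u w assume "u \<in> set (rev (hairpin (a # cs)))" "u = w @ [\<not> a]"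
    then show False using hairpin_suffix [of u a cs] by simp
  qed
  show "word_saw (turn a cs (\<not> a) z)"
    unfolding turn_eq_rev_hairpin using assms avoid
    by (intro word_saw_append) (auto simp del: hairpin.simps simp: last_rev)
  have "\<forall>u\<in>set (rev (hairpin (a # cs))). length u \<le> length [\<not> a] + M"
    using hairpin_depth_Cons [of _ a cs] assms(4) by (fastforce simp del: hairpin.simps)
  then show "tame M (turn a cs (\<not> a) z)"
    unfolding turn_eq_rev_hairpin using assms(3) z avoid by (intro tame_append) auto
qed

lemma turn_back:
  assumes "word_saw d" "hd d = []" "tame M d" "length cs \<le> Suc M" "cs \<noteq> [] \<longrightarrow> hd cs \<noteq> c"
  shows "word_saw (turn a cs a (below [c] d))" "tame M (turn a cs a (below [c] d))"
proof -
  have eq: "turn a cs a (below [c] d) = rev (hairpin (a # cs)) @ below [c, a] d"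
    by (simp add: rev_map)
  have d: "d \<noteq> []" using assms by (simp add: word_saw_def)
  have "\<nexists>w. u = w @ [c]" if "u \<in> set (hairpin cs)" for u
    using hairpin_suffix [of u "hd cs" "tl cs"] assms(5) that by (cases cs) auto
  then have avoid: "\<forall>u\<in>set (rev (hairpin (a # cs))). \<nexists>w. u = w @ [c, a]"
    by (auto simp: append_eq_append_conv2)
  show "word_saw (turn a cs a (below [c] d))"
    unfolding eq using assms avoid word_adj_root_append [of "[c]" a]
    by (intro word_saw_append) (auto simp del: hairpin.simps simp: last_rev)
  have "\<forall>u\<in>set (rev (hairpin (a # cs))). length u \<le> length [c, a] + M"
    using hairpin_depth_Cons [of _ a cs] assms(4) by (fastforce simp del: hairpin.simps)
  then show "tame M (turn a cs a (below [c] d))"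
    unfolding eq using assms(3) d avoid by (intro tame_append) auto
qed

definition tame_root :: "nat \<Rightarrow> nat \<Rightarrow> bool list list set" where
  "tame_root M n = {xs. word_saw xs \<and> hd xs = [] \<and> length xs = Suc n \<and> tame M xs}"

definition tame_child :: "nat \<Rightarrow> nat \<Rightarrow> bool list list set" where
  "tame_child M n = {xs. word_saw xs \<and> length (hd xs) = 1 \<and> length xs = Suc n \<and> tame M xs}"

lemma finite_tame_root [simp]: "finite (tame_root M n)"
  by (rule finite_subset [OF _ finite_root_saws [of "Suc n"]]) (auto simp: root_saws_def tame_root_def)

lemma finite_tame_child [simp]: "finite (tame_child M n)"
  by (rule finite_subset [OF _ finite_child_saws [of "Suc n"]]) (auto simp: child_saws_def tame_child_def)

lemma tame_root_child_disjoint: "tame_root M n \<inter> tame_child M n = {}"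
  by (auto simp: tame_root_def tame_child_def)

definition depth_sum :: "real \<Rightarrow> bool list list set \<Rightarrow> real" where
  "depth_sum y X = (\<Sum>xs\<in>X. y ^ length (last xs))"

lemma depth_sum_reindex:
  assumes "inj_on f I" "\<And>i. i \<in> I \<Longrightarrow> length (last (f i)) = k + length (last (g i))"
  shows "depth_sum y (f ` I) = y ^ k * (\<Sum>i\<in>I. y ^ length (last (g i)))"
  using assms by (simp add: depth_sum_def sum.reindex sum_distrib_left power_add)

lemma tame_root_sum_ge:
  assumes "0 \<le> y"
  shows "2 * y * (depth_sum y (tame_root M n) + depth_sum y (tame_child M n))
    \<le> depth_sum y (tame_root M (Suc n))"
proof -
  let ?Z = "tame_root M n \<union> tame_child M n"
  let ?f = "\<lambda>(b, z). [] # below [b] z"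
  have Z: "word_saw z" "length (hd z) \<le> 1" "length z = Suc n" "tame M z" "z \<noteq> []" if "z \<in> ?Z" for z
    using that by (auto simp: tame_root_def tame_child_def word_saw_def)
  have inj: "inj_on ?f (UNIV \<times> ?Z)"
    using Z(5) by (auto simp: inj_on_def below_branch_eq simp del: map_eq_conv)
  have "2 * y * (depth_sum y (tame_root M n) + depth_sum y (tame_child M n)) = 2 * y * depth_sum y ?Z"
    unfolding depth_sum_def by (subst sum.union_disjoint) (auto simp: tame_root_child_disjoint)
  also have "\<dots> = y ^ 1 * (\<Sum>p\<in>(UNIV :: bool set) \<times> ?Z. y ^ length (last (snd p)))"
    by (simp add: depth_sum_def sum.cartesian_product')
  also have "\<dots> = depth_sum y (?f ` (UNIV \<times> ?Z))"
    by (rule depth_sum_reindex [symmetric, OF inj]) (auto simp: Z(5) last_map)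
  also have "\<dots> \<le> depth_sum y (tame_root M (Suc n))"
    unfolding depth_sum_def
  proof (rule sum_mono2)
    show "?f ` (UNIV \<times> ?Z) \<subseteq> tame_root M (Suc n)"
    proof clarify
      fix b z assume z: "z \<in> ?Z"
      have "tame M ([[]] @ below [b] z)" using Z [OF z] by (intro tame_append) auto
      then show "[] # below [b] z \<in> tame_root M (Suc n)"
        using Z [OF z] by (auto simp: tame_root_def word_saw_Cons_root)
    qed
  qed (use assms in auto)
  finally show ?thesis .
qed

text \<open>
  The cases of \<open>child_saw_cases\<close> in the opposite direction, restricted to hairpins of at most \<open>M\<close>
  letters: they give disjoint families of tame walks.
\<close>
lemma tame_child_sum_ge:
  fixes M defines "C \<equiv> {cs :: bool list. length cs \<le> M}"
  assumes y: "0 \<le> y" and n: "M + 3 \<le> n"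
  shows "2 * y * depth_sum y (tame_root M n)
     + 2 * y * (\<Sum>cs\<in>C. depth_sum y (tame_root M (n - 2 - length cs))
                       + depth_sum y (tame_child M (n - 2 - length cs)))
     + 4 * y^2 * depth_sum y (tame_root M (n - 2))
     + 4 * y^2 * (\<Sum>cs\<in>C. depth_sum y (tame_root M (n - 3 - length cs)))
    \<le> depth_sum y (tame_child M n)"
proof -
  let ?Z = "\<lambda>k. tame_root M k \<union> tame_child M k"
  have Z: "word_saw z" "length (hd z) \<le> 1" "length z = Suc k" "tame M z" "z \<noteq> []"
    if "z \<in> ?Z k" for z k
    using that by (auto simp: tame_root_def tame_child_def word_saw_def)
  have R: "word_saw z" "hd z = []" "length z = Suc k" "tame M z" "z \<noteq> []"
    if "z \<in> tame_root M k" for z k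
    using that by (auto simp: tame_root_def word_saw_def)
  have ne: "[] \<notin> tame_root M k" "[] \<notin> tame_child M k" for k
    using Z(5) [of "[]" k] by auto
  have C: "finite C" by (simp add: C_def)
  define I1 where "I1 = (UNIV :: bool set) \<times> tame_root M n"
  define I2 where "I2 = (SIGMA (a, cs) : (UNIV :: bool set) \<times> C. ?Z (n - 2 - length cs))"
  define I3 where "I3 = ((UNIV :: bool set) \<times> (UNIV :: bool set)) \<times> tame_root M (n - 2)"
  define I4 where "I4 = (SIGMA (a, c, cs) : (UNIV :: bool set) \<times> (UNIV :: bool set) \<times> C.
                           tame_root M (n - 3 - length cs))"
  define f1 where "f1 = (\<lambda>(a, d). below [a] d)"
  define f2 where "f2 = (\<lambda>((a, cs), z). turn a cs (\<not> a) z)"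
  define f3 where "f3 = (\<lambda>((a, c), d). turn a [] a (below [c] d))"
  define f4 where "f4 = (\<lambda>((a, c, cs), d). turn a (c # cs) a (below [\<not> c] d))"
  have fin: "finite I1" "finite I2" "finite I3" "finite I4"
    unfolding I1_def I2_def I3_def I4_def using C by auto
  have inj1: "inj_on f1 I1"
    by (auto simp: inj_on_def f1_def I1_def below_branch_eq R simp del: map_eq_conv)
  have inj2: "inj_on f2 I2"
    unfolding inj_on_def f2_def I2_def using Z(5) by (clarsimp simp del: append_Cons) (metis turn_eq_iff)
  have inj3: "inj_on f3 I3"
    unfolding inj_on_def f3_def I3_def using R(5)
    by clarify (simp add: turn_eq_iff below_branch_eq del: map_map)
  have inj4: "inj_on f4 I4"
    unfolding inj_on_def f4_def I4_def using R(5)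
    by clarify (simp add: turn_eq_iff below_branch_eq del: map_map hairpin.simps)
  have s1: "depth_sum y (f1 ` I1) = 2 * y * depth_sum y (tame_root M n)"
    by (subst depth_sum_reindex [OF inj1, where k = 1 and g = snd])
      (auto simp: f1_def I1_def R last_map depth_sum_def sum.cartesian_product')
  have s2: "depth_sum y (f2 ` I2) = 2 * y * (\<Sum>cs\<in>C. depth_sum y (tame_root M (n - 2 - length cs))
                       + depth_sum y (tame_child M (n - 2 - length cs)))"
  proof -
    have "depth_sum y (f2 ` I2) = y ^ 1 * (\<Sum>i\<in>I2. y ^ length (last (snd i)))"
      by (rule depth_sum_reindex [OF inj2]) (auto simp: f2_def I2_def Z last_map ne)
    also have "(\<Sum>i\<in>I2. y ^ length (last (snd i)))
        = (\<Sum>(a, cs)\<in>(UNIV :: bool set) \<times> C. \<Sum>z\<in>?Z (n - 2 - length cs). y ^ length (last z))"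
      unfolding I2_def by (simp add: split_def sum.Sigma C)
    also have "\<dots> = (\<Sum>(a, cs)\<in>(UNIV :: bool set) \<times> C. depth_sum y (tame_root M (n - 2 - length cs))
                       + depth_sum y (tame_child M (n - 2 - length cs)))"
      by (intro sum.cong refl) (auto simp: depth_sum_def sum.union_disjoint tame_root_child_disjoint)
    finally show ?thesis by (simp add: sum.cartesian_product')
  qed
  have s3: "depth_sum y (f3 ` I3) = 4 * y^2 * depth_sum y (tame_root M (n - 2))"
    by (subst depth_sum_reindex [OF inj3, where k = 2 and g = snd])
      (auto simp: f3_def I3_def R last_map depth_sum_def sum.cartesian_product' simp del: UNIV_Times_UNIV)
  have s4: "depth_sum y (f4 ` I4) = 4 * y^2 * (\<Sum>cs\<in>C. depth_sum y (tame_root M (n - 3 - length cs)))"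
  proof -
    have "depth_sum y (f4 ` I4) = y ^ 2 * (\<Sum>i\<in>I4. y ^ length (last (snd i)))"
      by (rule depth_sum_reindex [OF inj4]) (auto simp: f4_def I4_def R last_map)
    also have "(\<Sum>i\<in>I4. y ^ length (last (snd i)))
        = (\<Sum>(a, c, cs)\<in>(UNIV :: bool set) \<times> (UNIV :: bool set) \<times> C.
            depth_sum y (tame_root M (n - 3 - length cs)))"
      unfolding I4_def by (simp add: split_def sum.Sigma C depth_sum_def)
    finally show ?thesis by (simp add: sum.cartesian_product')
  qed
  have e2: "f2 ` I2 = {turn a cs (\<not> a) z |a cs z. length cs \<le> M \<and> z \<in> ?Z (n - 2 - length cs)}"
    unfolding f2_def I2_def C_def image_def by (simp add: split_def Bex_def) blast
  have e3: "f3 ` I3 = {turn a [] a (below [c] d) |a c d. d \<in> tame_root M (n - 2)}"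
    unfolding f3_def I3_def image_def by (simp add: split_def Bex_def) blast
  have e4: "f4 ` I4 = {turn a (c # cs) a (below [\<not> c] d) |a c cs d.
      length cs \<le> M \<and> d \<in> tame_root M (n - 3 - length cs)}"
    unfolding f4_def I4_def C_def image_def by (simp add: split_def Bex_def del: hairpin.simps) blast
  have sub1: "f1 ` I1 \<subseteq> tame_child M n"
    using tame_append [of M _ "[]"] by (auto simp: f1_def I1_def R tame_child_def hd_map)
  have hd_turn: "length (hd (turn a cs b z)) = 1" for a cs b z
    by (simp add: hd_map)
  have sub2: "f2 ` I2 \<subseteq> tame_child M n"
  proof
    fix xs assume "xs \<in> f2 ` I2"
    then obtain a cs z where *: "xs = turn a cs (\<not> a) z" "length cs \<le> M" "z \<in> ?Z (n - 2 - length cs)"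
      unfolding e2 by blast
    then have "length xs = Suc n" using Z(3) [OF *(3)] n by simp
    then show "xs \<in> tame_child M n"
      using turn_away [of z M cs a] Z [OF *(3)] *(1,2) hd_turn by (simp add: tame_child_def)
  qed
  have sub3: "f3 ` I3 \<subseteq> tame_child M n"
  proof
    fix xs assume "xs \<in> f3 ` I3"
    then obtain a c d where *: "xs = turn a [] a (below [c] d)" "d \<in> tame_root M (n - 2)"
      unfolding e3 by blast
    then have "length xs = Suc n" using R(3) [OF *(2)] n by simp
    then show "xs \<in> tame_child M n"
      using turn_back [of d M "[]" c a] R [OF *(2)] *(1) hd_turn by (simp add: tame_child_def)
  qed
  have sub4: "f4 ` I4 \<subseteq> tame_child M n"
  proof
    fix xs assume "xs \<in> f4 ` I4"
    then obtain a c cs d where *: "xs = turn a (c # cs) a (below [\<not> c] d)" "length cs \<le> M"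
        "d \<in> tame_root M (n - 3 - length cs)"
      unfolding e4 by blast
    then have "length xs = Suc n" using R(3) [OF *(3)] n by (simp del: hairpin.simps)
    then show "xs \<in> tame_child M n"
      using turn_back [of d M "c # cs" "\<not> c" a] R [OF *(3)] *(1,2) hd_turn [of a "c # cs"]
      by (simp add: tame_child_def del: hairpin.simps map_map)
  qed
  have root: "[] \<in> set (turn a cs b z)" for a cs b z by simp
  have "[] \<notin> set xs" if "xs \<in> f1 ` I1" for xs using that by (auto simp: f1_def I1_def)
  moreover have "[] \<in> set xs" if "xs \<in> f2 ` I2 \<union> f3 ` I3 \<union> f4 ` I4" for xs
    using that root unfolding e2 e3 e4 by blast
  ultimately have d1: "f1 ` I1 \<inter> (f2 ` I2 \<union> f3 ` I3 \<union> f4 ` I4) = {}" by blast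
  have "turn a cs (\<not> a) z \<noteq> turn a' cs' a' (below e d)"
    if "z \<in> ?Z k" "d \<in> tame_root M l" for a cs z a' cs' e d k l
    using that turn_eq_iff [of z "below e d" a cs "\<not> a" a' cs' a'] Z(5) R(5) by blast
  then have d2: "f2 ` I2 \<inter> (f3 ` I3 \<union> f4 ` I4) = {}"
    unfolding e2 e3 e4 by blast
  have "turn a [] a (below e d) \<noteq> turn a' (c # cs') a' (below e' d')"
    if "d \<in> tame_root M k" "d' \<in> tame_root M l" for a a' c cs' e e' d d' k l
    using that turn_eq_iff [of "below e d" "below e' d'" a "[]" a a' "c # cs'" a'] R(5) by blast
  then have d3: "f3 ` I3 \<inter> f4 ` I4 = {}"
    unfolding e3 e4 by blast
  have "depth_sum y (f1 ` I1) + (depth_sum y (f2 ` I2) + (depth_sum y (f3 ` I3) + depth_sum y (f4 ` I4)))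
      = depth_sum y (f1 ` I1 \<union> (f2 ` I2 \<union> (f3 ` I3 \<union> f4 ` I4)))"
    unfolding depth_sum_def using fin d1 d2 d3
    by (simp add: sum.union_disjoint Un_assoc)
  also have "\<dots> \<le> depth_sum y (tame_child M n)"
    unfolding depth_sum_def using sub1 sub2 sub3 sub4 y by (intro sum_mono2) auto
  finally show ?thesis unfolding s1 s2 s3 s4 by simp
qed

section \<open>Growth of the number of walks with a deepest endpoint\<close>

lemma tame_root_nonempty: "tame_root M n \<noteq> {}"
proof (induction n)
  case 0
  have "[[]] \<in> tame_root M 0" by (simp add: tame_root_def word_saw_def tame_def)
  then show ?case by blast
next
  case (Suc n)
  then obtain z where z: "z \<in> tame_root M n" by blast
  then have "tame M ([[]] @ below [True] z)"
    by (intro tame_append) (auto simp: tame_root_def word_saw_def)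
  with z have "[] # below [True] z \<in> tame_root M (Suc n)"
    by (auto simp: tame_root_def word_saw_root_below)
  then show ?case by blast
qed

lemma tame_child_nonempty: "tame_child M n \<noteq> {}"
proof -
  obtain d where d: "d \<in> tame_root M n" using tame_root_nonempty by blast
  then have "d \<noteq> []" by (auto simp: tame_root_def word_saw_def)
  with d have "below [True] d \<in> tame_child M n"
    using tame_append [of M d "[]" "[True]"] by (auto simp: tame_root_def tame_child_def hd_map)
  then show ?thesis by blast
qed

lemma depth_sum_pos: "finite X \<Longrightarrow> X \<noteq> {} \<Longrightarrow> 0 < y \<Longrightarrow> 0 < depth_sum y X"
  by (auto simp: depth_sum_def intro!: sum_pos)

text \<open>
  The pair \<open>(1, a)\<close>, with \<open>a\<close> solving the equation \<open>2 x y (1 + a) = 1\<close> of the walks from the root, is a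
  subinvariant vector of the recursion, so a bound by a multiple of \<open>(1, a)\<close> propagates from the first
  \<open>M + 3\<close> lengths to all others.
\<close>
lemma tame_growth:
  fixes x y :: real and M :: nat
  assumes x: "0 < x" and y: "0 < y" and xy: "2 * x * y < 1"
  defines "g \<equiv> (\<Sum>cs\<in>{cs :: bool list. length cs \<le> M}. x ^ length cs)"
  assumes super: "1 \<le> renewal x y (x * g)"
  obtains c where "c > 0" "\<And>n. c * (1 / x) ^ n \<le> depth_sum y (tame_root M n)"
proof -
  define C where "C = {cs :: bool list. length cs \<le> M}"
  \<comment> \<open>\<open>a\<close> is chosen so that the recursion for the walks from the root holds with equality.\<close>
  define a where "a = (1 - 2 * x * y) / (2 * x * y)"
  have a: "a > 0" using x y xy by (simp add: a_def)
  have a1: "2 * x * y * (1 + a) = 1" using x y by (simp add: a_def field_simps)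
  have "2 * x * y * a = 1 - 2 * x * y" using a1 by (simp add: algebra_simps)
  also have "\<dots> \<le> 2 * x * y * (2 * y + 4 * x^2 * y^2 + (1 + 4 * x^2 * y^2) * (x * g))"
    using super by (simp add: renewal_def algebra_simps)
  finally have a2: "a \<le> 2 * y + 4 * x^2 * y^2 + (1 + 4 * x^2 * y^2) * (x * g)"
    using x y by (simp add: mult_le_cancel_left_pos)
  define R where "R n = depth_sum y (tame_root M n)" for n
  define K where "K n = depth_sum y (tame_child M n)" for n
  have RK: "R n > 0" "K n > 0" for n
    using y by (auto simp: R_def K_def tame_root_nonempty tame_child_nonempty intro!: depth_sum_pos)
  \<comment> \<open>The recursion for the walks from a child reaches back at most \<open>M + 3\<close> steps.\<close>
  define c where "c = Min ((\<lambda>n. min (x ^ n * R n) (x ^ n * K n / a)) ` {..<M + 3})"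
  have c: "c > 0" unfolding c_def using RK x a by (subst Min_gr_iff) (auto simp: lessThan_empty_iff)
  have "c \<le> x ^ n * R n \<and> c * a \<le> x ^ n * K n" for n
  proof (induction n rule: less_induct)
    case (less n)
    show ?case
    proof (cases "n < M + 3")
      case True
      then have "c \<le> min (x ^ n * R n) (x ^ n * K n / a)"
        unfolding c_def by (intro Min_le) auto
      then show ?thesis using a by (simp add: field_simps)
    next
      case False
      then have n: "M + 3 \<le> n" by simp
      have IH: "c \<le> x ^ k * R k" "c * (1 + a) \<le> x ^ k * (R k + K k)" if "k < n" for k
        using less [OF that] by (auto simp: algebra_simps)
      obtain m where m: "n = Suc m" using n by (cases n) auto
      have "c = 2 * x * y * (c * (1 + a))"
        using arg_cong [OF a1, of "\<lambda>t. c * t"] by (simp add: mult_ac)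
      also have "\<dots> \<le> 2 * x * y * (x ^ m * (R m + K m))"
        using IH(2) [of m] m x y by (intro mult_left_mono) auto
      also have "\<dots> = x ^ n * (2 * y * (R m + K m))" by (simp add: m)
      also have "\<dots> \<le> x ^ n * R n"
        using tame_root_sum_ge [of y M m] x y by (intro mult_left_mono) (auto simp: R_def K_def m)
      finally have 1: "c \<le> x ^ n * R n" .
      have rescale: "x ^ (k + l) * t \<le> x ^ n * s" if "n = k + l + j" "t \<le> x ^ j * s" for j k l t s
        using mult_left_mono [OF that(2), of "x ^ (k + l)"] that(1) x
        by (simp add: power_add mult.assoc)
      have sA: "(\<Sum>cs\<in>C. x ^ (2 + length cs) * (c * (1 + a))) = x^2 * (c * (1 + a)) * g"
        by (simp add: C_def g_def sum_distrib_left power_add power2_eq_square power3_eq_cube mult_ac)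
      have sB: "(\<Sum>cs\<in>C. x ^ (3 + length cs) * c) = x^3 * c * g"
        by (simp add: C_def g_def sum_distrib_left power_add power2_eq_square power3_eq_cube mult_ac)
      have t2: "x ^ (2 + length cs) * (c * (1 + a))
          \<le> x ^ n * (R (n - 2 - length cs) + K (n - 2 - length cs))" if "cs \<in> C" for cs
        using that n by (intro rescale [where j = "n - 2 - length cs"] IH) (auto simp: C_def)
      have t3: "x ^ (2 + 0) * c \<le> x ^ n * R (n - 2)"
        using n by (intro rescale [where j = "n - 2"] IH) auto
      have t4: "x ^ (3 + length cs) * c \<le> x ^ n * R (n - 3 - length cs)" if "cs \<in> C" for cs
        using that n by (intro rescale [where j = "n - 3 - length cs"] IH) (auto simp: C_def)
      have "c * a \<le> c * (2 * y + 4 * x^2 * y^2 + (1 + 4 * x^2 * y^2) * (x * g))"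
        using a2 c by (intro mult_left_mono) auto
      also have "\<dots> = 2 * y * c + (2 * x * y * (1 + a)) * (x * g * c) + 4 * y^2 * (x ^ (2 + 0) * c)
          + 4 * y^2 * (x^3 * g * c)"
        unfolding a1 by (simp add: algebra_simps power2_eq_square power3_eq_cube)
      also have "\<dots> = 2 * y * c + 2 * y * (\<Sum>cs\<in>C. x ^ (2 + length cs) * (c * (1 + a)))
          + 4 * y^2 * (x ^ (2 + 0) * c) + 4 * y^2 * (\<Sum>cs\<in>C. x ^ (3 + length cs) * c)"
        unfolding sA sB by (simp add: power2_eq_square mult_ac)
      also have "\<dots> \<le> 2 * y * (x ^ n * R n)
          + 2 * y * (\<Sum>cs\<in>C. x ^ n * (R (n - 2 - length cs) + K (n - 2 - length cs)))
          + 4 * y^2 * (x ^ n * R (n - 2))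
          + 4 * y^2 * (\<Sum>cs\<in>C. x ^ n * R (n - 3 - length cs))"
        by (intro add_mono mult_left_mono 1 sum_mono t2 t3 t4) (use y in simp_all)
      also have "\<dots> = x ^ n * (2 * y * R n
          + 2 * y * (\<Sum>cs\<in>C. R (n - 2 - length cs) + K (n - 2 - length cs))
          + 4 * y^2 * R (n - 2) + 4 * y^2 * (\<Sum>cs\<in>C. R (n - 3 - length cs)))"
        by (simp add: sum_distrib_left algebra_simps)
      also have "\<dots> \<le> x ^ n * K n"
        unfolding C_def R_def K_def using x y n
        by (intro mult_left_mono tame_child_sum_ge) auto
      finally show ?thesis using 1 by simp
    qed
  qed
  then have "c * (1 / x) ^ n \<le> R n" for n
    using x by (simp add: power_one_over field_simps)
  with c that show ?thesis unfolding R_def by blast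
qed

fun descent :: "nat \<Rightarrow> bool list list" where
  "descent 0 = [[]]"
| "descent (Suc k) = [] # below [False] (descent k)"

lemma descent_props:
  "descent k \<noteq> []" "hd (descent k) = []" "length (descent k) = Suc k"
  "length (last (descent k)) = k" "word_saw (descent k)"
proof -
  show ne: "descent k \<noteq> []" for k by (cases k) auto
  show "hd (descent k) = []" for k by (cases k) auto
  then show "word_saw (descent k)"
    by (induction k) (simp add: word_saw_def, auto simp: word_saw_root_below)
  show "length (descent k) = Suc k" by (induction k) auto
  show "length (last (descent k)) = k" by (induction k) (auto simp: ne last_map)
qed

lemma descent_below_last: "u \<in> set (butlast (descent k)) \<Longrightarrow> length u < k"
  by (induction k arbitrary: u) (auto simp: map_butlast [symmetric] descent_props(1) split: if_splits)

text \<open>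
  Bridges, read in the words, whose maximal height is attained at the end only. Read backwards,
  the same walks are the reversed bridges.
\<close>
definition peak_saws :: "nat \<Rightarrow> bool list list set" where
  "peak_saws n = {xs \<in> saws word_adj [] n. \<forall>u\<in>set (butlast xs). length u < length (last xs)}"

lemma finite_word_saws [simp]: "finite (saws word_adj [] n)"
  by (rule finite_subset [OF _ finite_root_saws [of "Suc n"]])
    (auto simp: saws_def root_saws_def word_saw_def)

lemma finite_peak_saws [simp]: "finite (peak_saws n)"
  by (simp add: peak_saws_def)

lemma peak_saws_ge_tame:
  assumes y: "0 < y"
  shows "y ^ Suc M * depth_sum y (tame_root M n) \<le> depth_sum y (peak_saws (n + Suc M))"
proof -
  define f where "f = (\<lambda>xs. butlast xs @ below (last xs) (descent (Suc M)))"
  have R: "word_saw xs" "hd xs = []" "length xs = Suc n" "tame M xs" "xs \<noteq> []"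
    if "xs \<in> tame_root M n" for xs
    using that by (auto simp: tame_root_def word_saw_def)
  have inj: "inj_on f (tame_root M n)"
  proof (rule inj_onI)
    fix xs ys assume *: "xs \<in> tame_root M n" "ys \<in> tame_root M n" "f xs = f ys"
    then have "butlast xs = butlast ys" "last xs = last ys"
      unfolding f_def by (auto simp: R)
    then show "xs = ys" using R(5) *(1,2) by (metis append_butlast_last_id)
  qed
  have last: "last (f xs) = last (descent (Suc M)) @ last xs" for xs
    by (simp add: f_def last_map descent_props(1) del: descent.simps)
  have "y ^ Suc M * depth_sum y (tame_root M n) = depth_sum y (f ` tame_root M n)"
    by (subst depth_sum_reindex [OF inj, where k = "Suc M" and g = id])
      (simp_all add: last descent_props depth_sum_def del: descent.simps)
  also have "\<dots> \<le> depth_sum y (peak_saws (n + Suc M))"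
    unfolding depth_sum_def
  proof (rule sum_mono2)
    show "f ` tame_root M n \<subseteq> peak_saws (n + Suc M)"
    proof (rule image_subsetI)
      fix xs assume xs: "xs \<in> tame_root M n"
      note xs = R [OF xs]
      have saw: "word_saw (f xs)"
      proof (cases "butlast xs = []")
        case True
        then show ?thesis by (simp add: f_def descent_props(5) del: descent.simps)
      next
        case False
        have "word_saw (butlast xs @ [last xs])" using xs by simp
        then have "word_saw (butlast xs)" "word_adj (last (butlast xs)) (last xs)"
          using False unfolding word_saw_def successively_append_iff by auto
        then show ?thesis unfolding f_def using xs(4)
          by (intro word_saw_append) (auto simp: descent_props tame_def simp del: descent.simps)
      qed
      moreover have "hd (f xs) = []"
      proof (cases "butlast xs = []")
        case True
        then have "xs = [[]]" using xs by (metis append_Nil append_butlast_last_id list.sel(1))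
        then show ?thesis by (simp add: f_def)
      next
        case False
        then have "hd (butlast xs) = hd xs" by (cases xs) (auto split: if_splits)
        then show ?thesis using False xs(2) by (simp add: f_def)
      qed
      moreover have "length (f xs) = Suc (n + Suc M)"
        using xs by (simp add: f_def descent_props del: descent.simps)
      moreover have "length u < length (last (f xs))" if "u \<in> set (butlast (f xs))" for u
      proof -
        have "butlast (f xs) = butlast xs @ below (last xs) (butlast (descent (Suc M)))"
          by (simp add: f_def butlast_append map_butlast descent_props(1) del: descent.simps)
        with that consider "u \<in> set xs" | v where "v \<in> set (butlast (descent (Suc M)))" "u = v @ last xs"
          using in_set_butlastD by (fastforce simp del: descent.simps)
        then show ?thesis
        proof cases
          case 1
          then have "length u \<le> length (last xs) + M" using xs(4) by (simp add: tame_def)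
          then show ?thesis by (simp add: last descent_props del: descent.simps)
        next
          case 2
          then show ?thesis
            using descent_below_last [of v "Suc M"] by (simp add: last descent_props del: descent.simps)
        qed
      qed
      ultimately show "f xs \<in> peak_saws (n + Suc M)"
        by (auto simp: peak_saws_def saws_def word_saw_def)
    qed
  qed (use y in auto)
  finally show ?thesis .
qed

text \<open>
  As \<open>M\<close> grows, the weight of the hairpins with at most \<open>M\<close> letters tends to that of all hairpins, and
  \<open>renewal\<close> is continuous.
\<close>
lemma peak_saws_ge:
  fixes x y :: real
  assumes x: "0 < x" "x < 1/2" and y: "0 < y" "y \<le> 1"
    and super: "1 < renewal x y (x / (1 - 2 * x))"
  obtains c N where "c > 0" "\<And>n. n \<ge> N \<Longrightarrow> c * (1 / x) ^ n \<le> depth_sum y (peak_saws n)"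
proof -
  let ?g = "\<lambda>M. \<Sum>cs\<in>{cs :: bool list. length cs \<le> M}. x ^ length cs"
  have "(\<lambda>n. (2 * x) ^ n) sums (1 / (1 - 2 * x))"
    using x by (intro geometric_sums) auto
  then have "?g \<longlonglongrightarrow> 1 / (1 - 2 * x)"
    unfolding sum_bool_lists sums_def_le .
  then have "(\<lambda>M. renewal x y (x * ?g M))
      \<longlonglongrightarrow> renewal x y (x * (1 / (1 - 2 * x)))"
    unfolding renewal_def by (intro tendsto_intros)
  then have "\<forall>\<^sub>F M in sequentially.
      1 < renewal x y (x * ?g M)"
    by (rule order_tendstoD) (use super in simp)
  then obtain M where M: "1 < renewal x y (x * ?g M)"
    by (meson eventually_sequentially order_refl)
  have "x * y \<le> x * 1" using x y by (intro mult_left_mono) auto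
  then have "2 * (x * y) < 1" using x by linarith
  then have "2 * x * y < 1" by (simp add: mult.assoc)
  then obtain c where c: "c > 0" "\<And>n. c * (1 / x) ^ n \<le> depth_sum y (tame_root M n)"
    using tame_growth [OF x(1) y(1) _ less_imp_le [OF M]] by blast
  have "y ^ Suc M * c * x ^ Suc M * (1 / x) ^ n \<le> depth_sum y (peak_saws n)" if "n \<ge> Suc M" for n
  proof -
    define k where "k = n - Suc M"
    have k: "n = k + Suc M" using that by (simp add: k_def)
    have "y ^ Suc M * c * x ^ Suc M * (1 / x) ^ n = y ^ Suc M * (c * (1 / x) ^ k)"
      using x by (simp add: k power_add power_one_over field_simps)
    also have "\<dots> \<le> y ^ Suc M * depth_sum y (tame_root M k)"
      using c y by (intro mult_left_mono) auto
    also have "\<dots> \<le> depth_sum y (peak_saws n)" using peak_saws_ge_tame [of y M k] y k by simp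
    finally show ?thesis .
  qed
  moreover have "y ^ Suc M * c * x ^ Suc M > 0" using x y c by simp
  ultimately show ?thesis using that by blast
qed

section \<open>Symmetry in the endpoint\<close>

text \<open>
  The automorphism of the rooted binary tree that exchanges, for every \<open>i\<close> with \<open>m i\<close>, the two
  children of each vertex in generation \<open>i\<close>.
\<close>
fun relabel :: "(nat \<Rightarrow> bool) \<Rightarrow> bool list \<Rightarrow> bool list" where
  "relabel m [] = []"
| "relabel m (b # w) = (b \<noteq> m (length w)) # relabel m w"

lemma length_relabel [simp]: "length (relabel m w) = length w"
  by (induction w) auto

lemma relabel_relabel [simp]: "relabel m (relabel m w) = w"
  by (induction w) auto

lemma relabel_eq_iff [simp]: "relabel m u = relabel m w \<longleftrightarrow> u = w"
  by (metis relabel_relabel)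

lemma word_adj_relabel: "word_adj u w \<Longrightarrow> word_adj (relabel m u) (relabel m w)"
  unfolding word_adj_def by fastforce

lemma relabel_cong: "(\<And>i. i < length w \<Longrightarrow> m i = m' i) \<Longrightarrow> relabel m w = relabel m' w"
  by (induction w) auto

lemma relabel_transitive:
  assumes "length u = length w"
  shows "\<exists>m. relabel m u = w"
  using assms
proof (induction rule: list_induct2)
  case (Cons b u c w)
  then obtain m where m: "relabel m u = w" by blast
  have "relabel (m(length u := (b \<noteq> c))) u = relabel m u"
    by (rule relabel_cong) simp
  then have "relabel (m(length u := (b \<noteq> c))) (b # u) = c # w" using m by auto
  then show ?case by blast
qed simp

lemma peak_saws_relabel:
  assumes "xs \<in> peak_saws n"
  shows "map (relabel m) xs \<in> peak_saws n"
proof -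
  have xs: "xs \<noteq> []" "hd xs = []" "successively word_adj xs" "distinct xs" "length xs = Suc n"
      "\<forall>u\<in>set (butlast xs). length u < length (last xs)"
    using assms by (auto simp: peak_saws_def saws_def)
  have "successively word_adj (map (relabel m) xs)"
    unfolding successively_map by (rule successively_mono [OF xs(3)]) (rule word_adj_relabel)
  then show ?thesis using xs
    by (auto simp: peak_saws_def saws_def hd_map distinct_map inj_on_def last_map
        map_butlast [symmetric])
qed

lemma card_peak_saws_endpoint_le:
  assumes "length e = length e'"
  shows "card {xs \<in> peak_saws n. last xs = e} \<le> card {xs \<in> peak_saws n. last xs = e'}"
proof -
  obtain m where m: "relabel m e = e'" using relabel_transitive [OF assms] by blast
  show ?thesis
  proof (rule card_inj_on_le)
    show "inj_on (map (relabel m)) {xs \<in> peak_saws n. last xs = e}"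
      by (rule inj_on_mapI) (simp add: inj_on_def)
    show "map (relabel m) ` {xs \<in> peak_saws n. last xs = e} \<subseteq> {xs \<in> peak_saws n. last xs = e'}"
    proof clarsimp
      fix xs assume xs: "xs \<in> peak_saws n" "e = last xs"
      then have "xs \<noteq> []" by (auto simp: peak_saws_def saws_def)
      then show "map (relabel m) xs \<in> peak_saws n \<and> last (map (relabel m) xs) = e'"
        using xs m by (simp add: peak_saws_relabel last_map)
    qed
  qed simp
qed

lemma card_peak_saws_depth:
  assumes "length e = k"
  shows "card {xs \<in> peak_saws n. length (last xs) = k} = 2 ^ k * card {xs \<in> peak_saws n. last xs = e}"
proof -
  let ?P = "{xs \<in> peak_saws n. length (last xs) = k}"
  let ?E = "{w :: bool list. length w = k}"
  have "card ?P = (\<Sum>xs\<in>?P. 1)" by simp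
  also have "\<dots> = (\<Sum>w\<in>?E. \<Sum>xs\<in>{xs \<in> ?P. last xs = w}. 1)"
    by (rule sum.group [symmetric])
      (auto intro: finite_subset [OF _ finite_bool_lists_le [of k]])
  also have "\<dots> = (\<Sum>w\<in>?E. card {xs \<in> peak_saws n. last xs = e})"
  proof (rule sum.cong [OF refl])
    fix w assume w: "w \<in> ?E"
    then have "{xs \<in> ?P. last xs = w} = {xs \<in> peak_saws n. last xs = w}" by auto
    moreover have "card {xs \<in> peak_saws n. last xs = w} = card {xs \<in> peak_saws n. last xs = e}"
      using w assms by (intro antisym card_peak_saws_endpoint_le) auto
    ultimately show "(\<Sum>xs\<in>{xs \<in> ?P. last xs = w}. 1) = card {xs \<in> peak_saws n. last xs = e}"
      by simp
  qed
  finally show ?thesis by (simp add: card_bool_lists)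
qed

text \<open>
  All words of length \<open>k\<close> are endpoints of equally many of these walks, so prescribing one endpoint
  \<open>e k\<close> in each generation is the same as dividing by \<open>2 ^ k\<close>.
\<close>
lemma depth_sum_half_peak_saws:
  assumes e: "\<And>k. length (e k) = k"
  shows "depth_sum (1/2) (peak_saws n)
    = real (card {xs \<in> peak_saws n. last xs = e (length (last xs))})"
proof -
  let ?P = "peak_saws n" and ?S = "{xs \<in> peak_saws n. last xs = e (length (last xs))}"
  let ?l = "\<lambda>xs :: bool list list. length (last xs)"
  have "depth_sum (1/2) ?P = (\<Sum>k\<in>?l ` ?P. \<Sum>xs\<in>{xs \<in> ?P. ?l xs = k}. (1/2) ^ ?l xs)"
    unfolding depth_sum_def by (rule sum.group [symmetric]) auto
  also have "\<dots> = (\<Sum>k\<in>?l ` ?P. \<Sum>xs\<in>{xs \<in> ?S. ?l xs = k}. 1)"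
  proof (rule sum.cong [OF refl])
    fix k
    have "(\<Sum>xs\<in>{xs \<in> ?P. ?l xs = k}. (1/2 :: real) ^ ?l xs) = (1/2) ^ k * real (card {xs \<in> ?P. ?l xs = k})"
      by simp
    also have "\<dots> = real (card {xs \<in> ?P. last xs = e k})"
      by (simp add: card_peak_saws_depth [OF e] power_one_over)
    also have "{xs \<in> ?P. last xs = e k} = {xs \<in> ?S. ?l xs = k}" using e by auto
    finally show "(\<Sum>xs\<in>{xs \<in> ?P. ?l xs = k}. (1/2 :: real) ^ ?l xs) = (\<Sum>xs\<in>{xs \<in> ?S. ?l xs = k}. 1)"
      by simp
  qed
  also have "\<dots> = (\<Sum>xs\<in>?S. 1)" by (rule sum.group) auto
  finally show ?thesis by simp
qed

section \<open>Words as descendants of a vertex\<close>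

text \<open>
  Everything about the tree and its end that matters for counting walks: the parent map, whose
  fibres are pairs, and the height.
\<close>
locale grandparent =
  fixes p :: "'v \<Rightarrow> 'v" and child :: "'v \<Rightarrow> bool \<Rightarrow> 'v" and h :: "'v \<Rightarrow> int"
    and G :: "'v \<Rightarrow> 'v \<Rightarrow> bool"
  assumes height_p: "h (p v) = h v - 1"
    and p_eq_iff: "p w = v \<longleftrightarrow> (\<exists>b. w = child v b)"
    and child_inject: "child v b = child v c \<longleftrightarrow> b = c"
    and G_iff: "G u v \<longleftrightarrow> v = p u \<or> u = p v \<or> v = p (p u) \<or> u = p (p v)"
begin

lemma p_child [simp]: "p (child v b) = v"
  using p_eq_iff by blast

lemma G_sym: "G u v = G v u"
  unfolding G_iff by blast

primrec embed :: "'v \<Rightarrow> bool list \<Rightarrow> 'v" where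
  "embed a [] = a"
| "embed a (b # w) = child (embed a w) b"

lemma height_embed: "h (embed a w) = h a + length w"
proof (induction w)
  case (Cons b w)
  then show ?case using height_p [of "embed a (b # w)"] by simp
qed simp

lemma embed_eq_iff [simp]: "embed a u = embed a w \<longleftrightarrow> u = w"
proof (induction u arbitrary: w)
  case Nil
  then show ?case using height_embed [of a w] by (cases w) auto
next
  case (Cons b u)
  show ?case
  proof (cases w)
    case Nil
    then show ?thesis using height_embed [of a "b # u"] by auto
  next
    case (Cons c w')
    have "b # u = c # w'" if eq: "embed a (b # u) = embed a (c # w')"
    proof -
      have "embed a u = embed a w'" using arg_cong [OF eq, of p] by simp
      then have "u = w'" using Cons.IH by blast
      with eq show ?thesis by (simp add: child_inject)
    qed
    then show ?thesis using Cons by blast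
  qed
qed

lemma p_embed_eq_iff: "embed a w = p (embed a u) \<longleftrightarrow> (\<exists>b. u = b # w)"
proof (cases u)
  case Nil
  then show ?thesis using height_embed [of a w] height_p [of a] by auto
qed auto

lemma pp_embed_eq_iff: "embed a w = p (p (embed a u)) \<longleftrightarrow> (\<exists>b c. u = b # c # w)"
proof (cases u)
  case Nil
  then show ?thesis using height_embed [of a w] height_p [of a] height_p [of "p a"] by auto
next
  case (Cons b u')
  then show ?thesis using p_embed_eq_iff [of a w u'] by simp
qed

lemma G_embed: "G (embed a u) (embed a w) \<longleftrightarrow> word_adj u w"
  unfolding G_iff p_embed_eq_iff pp_embed_eq_iff word_adj_def by blast

lemma funpow_p_embed: "(p ^^ length w) (embed a w) = a"
  by (induction w) (simp_all add: funpow_swap1)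

lemma ex_embed: "\<exists>w. length w = k \<and> embed ((p ^^ k) v) w = v"
proof (induction k arbitrary: v)
  case (Suc k)
  obtain w where w: "length w = k" "embed ((p ^^ k) (p v)) w = p v" using Suc by blast
  then obtain b where "v = child (embed ((p ^^ k) (p v)) w) b" using p_eq_iff by metis
  then have "length (b # w) = Suc k \<and> embed ((p ^^ Suc k) v) (b # w) = v"
    using w(1) by (simp add: funpow_swap1)
  then show ?case by blast
qed simp

text \<open>
  The descendants of \<open>a\<close> can only be left through the parent or the grandparent of a descendant, and an
  ancestor of \<open>a\<close> has smaller height than \<open>a\<close>.
\<close>
lemma embed_neighbour:
  assumes "G (embed a w) y" "h a \<le> h y"
  shows "y \<in> range (embed a)"
proof -
  consider "y = p (embed a w)" | "embed a w = p y" | "y = p (p (embed a w))" | "embed a w = p (p y)"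
    using assms(1) unfolding G_iff by blast
  then show ?thesis
  proof cases
    case 1
    then show ?thesis using assms(2) by (cases w) (auto simp: height_p)
  next
    case 2
    then obtain b where "y = embed a (b # w)" using p_eq_iff by (metis embed.simps(2))
    then show ?thesis by blast
  next
    case 3
    then obtain b c u where "w = b # c # u"
      using assms(2) by (cases w rule: remdups_adj.cases) (auto simp: height_p)
    then show ?thesis using 3 by simp
  next
    case 4
    then obtain b where b: "p y = embed a (b # w)" using p_eq_iff by (metis embed.simps(2))
    then obtain c where "y = embed a (c # b # w)" using p_eq_iff by (metis embed.simps(2))
    then show ?thesis by blast
  qed
qed

lemma walk_in_range_embed:
  assumes "successively G ys" "ys \<noteq> []" "hd ys \<in> range (embed a)" "\<forall>y\<in>set ys. h a \<le> h y"
  shows "set ys \<subseteq> range (embed a)"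
  using assms
proof (induction ys)
  case (Cons y ys)
  show ?case
  proof (cases "ys = []")
    case False
    then have "G y (hd ys)" "h a \<le> h (hd ys)" using Cons.prems by (auto simp: successively_Cons)
    moreover obtain w where "y = embed a w" using Cons.prems by auto
    ultimately have "hd ys \<in> range (embed a)" using embed_neighbour by blast
    then show ?thesis using Cons False by (auto simp: successively_Cons)
  qed (use Cons.prems in auto)
qed simp

lemma map_embed_saws:
  "map (embed a) d \<in> saws G (embed a w) n \<longleftrightarrow> d \<in> saws word_adj w n"
proof (cases "d = []")
  case False
  then show ?thesis
    by (simp add: saws_def successively_map G_embed distinct_map hd_map inj_on_def)
qed (simp add: saws_def)

lemma saws_above:
  assumes "ys \<in> saws G a n" "\<forall>y\<in>set ys. h a \<le> h y"
  obtains d where "d \<in> saws word_adj [] n" "ys = map (embed a) d"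
proof -
  have ys: "successively G ys" "ys \<noteq> []" "hd ys = embed a []"
    using assms(1) by (auto simp: saws_def)
  then have "set ys \<subseteq> range (embed a)"
    using walk_in_range_embed assms(2) by (metis rangeI)
  then obtain d where d: "ys = map (embed a) d"
    by (metis ex_map_conv subsetD rangeE)
  then have "d \<in> saws word_adj [] n"
    using assms(1) map_embed_saws [of a d "[]" n] by simp
  with d that show ?thesis by blast
qed

lemma saws_rev:
  assumes "xs \<in> saws G v n"
  shows "rev xs \<in> saws G (last xs) n"
proof -
  have "(\<lambda>u w. G w u) = G" by (intro ext G_sym)
  then have "successively G (rev xs) = successively G xs"
    unfolding successively_rev by (rule arg_cong)
  then show ?thesis using assms by (auto simp: saws_def hd_rev)
qed

text \<open>
  The walk is cut at a vertex \<open>a\<close> of minimal height, below which it stays; both pieces start at \<open>a\<close> when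
  the first one is reversed. The vertex \<open>a\<close> need not be recorded: it is the ancestor of \<open>v\<close> as many
  generations up as the endpoint of the first piece is deep.
\<close>
lemma saws_subset:
  "saws G v n \<subseteq> (\<Union>i\<le>n. (\<lambda>(d, d'). let a = (p ^^ length (last d)) v in
      rev (map (embed a) d) @ tl (map (embed a) d')) ` (saws word_adj [] i \<times> saws word_adj [] (n - i)))"
proof
  fix xs assume xs: "xs \<in> saws G v n"
  then have ne: "xs \<noteq> []" by (auto simp: saws_def)
  obtain a where a: "a \<in> set xs" "\<forall>y\<in>set xs. h a \<le> h y"
    using ex_is_arg_min_if_finite [of "set xs" h] ne by (auto simp: is_arg_min_linorder)
  then obtain pre suf where split: "xs = pre @ a # suf" by (meson split_list)
  have lens: "length pre + length suf = n" using xs split by (simp add: saws_def)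
  have "pre @ [a] \<in> saws G v (length pre)"
    using xs split by (auto simp: saws_def successively_append_iff successively_Cons hd_append)
  from saws_rev [OF this] have "a # rev pre \<in> saws G a (length pre)" by simp
  moreover have "\<forall>y\<in>set (a # rev pre). h a \<le> h y" using a split by auto
  ultimately obtain d where d: "d \<in> saws word_adj [] (length pre)" "a # rev pre = map (embed a) d"
    by (rule saws_above)
  have "a # suf \<in> saws G a (length suf)"
    using xs split by (auto simp: saws_def successively_append_iff)
  moreover have "\<forall>y\<in>set (a # suf). h a \<le> h y" using a split by auto
  ultimately obtain d' where d': "d' \<in> saws word_adj [] (length suf)" "a # suf = map (embed a) d'"
    by (rule saws_above)
  have "d \<noteq> []" using d by auto
  then have "embed a (last d) = last (a # rev pre)" unfolding d(2) by (simp add: last_map)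
  also have "\<dots> = hd xs" using split by (cases pre) (auto simp: last_rev)
  also have "\<dots> = v" using xs by (simp add: saws_def)
  finally have "(p ^^ length (last d)) v = a" using funpow_p_embed by metis
  moreover have "xs = rev (map (embed a) d) @ tl (map (embed a) d')"
    unfolding d(2) [symmetric] d'(2) [symmetric] using split by simp
  ultimately have "xs \<in> (\<lambda>(d, d'). let a = (p ^^ length (last d)) v in
      rev (map (embed a) d) @ tl (map (embed a) d'))
        ` (saws word_adj [] (length pre) \<times> saws word_adj [] (n - length pre))"
    using d d' lens by (intro image_eqI [of _ _ "(d, d')"]) (auto simp: Let_def)
  then show "xs \<in> (\<Union>i\<le>n. (\<lambda>(d, d'). let a = (p ^^ length (last d)) v in
      rev (map (embed a) d) @ tl (map (embed a) d')) ` (saws word_adj [] i \<times> saws word_adj [] (n - i)))"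
    using lens by (intro UN_I [of "length pre"]) auto
qed

lemma finite_saws [simp]: "finite (saws G v n)"
  by (rule finite_subset [OF saws_subset]) auto

lemma card_saws_le:
  "card (saws G v n) \<le> (\<Sum>i\<le>n. card (saws word_adj [] i) * card (saws word_adj [] (n - i)))"
proof -
  let ?f = "\<lambda>(d, d'). let a = (p ^^ length (last d)) v in
      rev (map (embed a) d) @ tl (map (embed a) d')"
  let ?I = "\<lambda>i. saws word_adj [] i \<times> saws word_adj [] (n - i)"
  have "card (saws G v n) \<le> card (\<Union>i\<le>n. ?f ` ?I i)"
    by (rule card_mono [OF _ saws_subset]) auto
  also have "\<dots> \<le> (\<Sum>i\<le>n. card (?f ` ?I i))" by (rule card_UN_le) simp
  also have "\<dots> \<le> (\<Sum>i\<le>n. card (?I i))" by (intro sum_mono card_image_le) simp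
  finally show ?thesis by (simp add: card_cartesian_product)
qed

lemma nth_ball_tl:
  assumes "length xs = Suc n"
  shows "(\<forall>i\<in>{1..n}. P (xs ! i)) \<longleftrightarrow> (\<forall>x\<in>set (tl xs). P x)" "xs ! n = last xs"
proof -
  obtain y ys where xs: "xs = y # ys" using assms by (cases xs) auto
  have "(\<forall>i\<in>{1..n}. P (xs ! i)) \<longleftrightarrow> (\<forall>i<n. P (ys ! i))"
    unfolding image_Suc_lessThan [symmetric] xs by (auto simp del: image_Suc_lessThan)
  then show "(\<forall>i\<in>{1..n}. P (xs ! i)) \<longleftrightarrow> (\<forall>x\<in>set (tl xs). P x)"
    using assms xs by (simp add: all_set_conv_all_nth)
  show "xs ! n = last xs" using assms last_conv_nth [of xs] by (auto simp: xs)
qed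

lemma bridges_alt: "bridges G h v n = {xs \<in> saws G v n. \<forall>y\<in>set (tl xs). h v < h y \<and> h y \<le> h (last xs)}"
  unfolding bridges_def
proof (intro Collect_cong conj_cong refl)
  fix xs assume "xs \<in> saws G v n"
  then have xs: "length xs = Suc n" by (simp add: saws_def)
  show "(\<forall>i\<in>{1..n}. h v < h (xs ! i) \<and> h (xs ! i) \<le> h (xs ! n))
      \<longleftrightarrow> (\<forall>y\<in>set (tl xs). h v < h y \<and> h y \<le> h (last xs))"
    unfolding nth_ball_tl(2) [OF xs] by (rule nth_ball_tl(1) [OF xs])
qed

lemma rev_bridges_alt:
  "rev_bridges G h v n = {xs \<in> saws G v n. \<forall>y\<in>set (tl xs). h y < h v \<and> h (last xs) \<le> h y}"
  unfolding rev_bridges_def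
proof (intro Collect_cong conj_cong refl)
  fix xs assume "xs \<in> saws G v n"
  then have xs: "length xs = Suc n" by (simp add: saws_def)
  show "(\<forall>i\<in>{1..n}. h v > h (xs ! i) \<and> h (xs ! i) \<ge> h (xs ! n))
      \<longleftrightarrow> (\<forall>y\<in>set (tl xs). h y < h v \<and> h (last xs) \<le> h y)"
    unfolding nth_ball_tl(2) [OF xs] by (rule nth_ball_tl(1) [OF xs])
qed

lemma card_bridges_ge: "card (peak_saws n) \<le> card (bridges G h v n)"
proof (rule card_inj_on_le)
  show "inj_on (map (embed v)) (peak_saws n)" by (rule inj_on_mapI) (simp add: inj_on_def)
  show "finite (bridges G h v n)" by (simp add: bridges_def)
  show "map (embed v) ` peak_saws n \<subseteq> bridges G h v n"
  proof (rule image_subsetI)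
    fix d assume d: "d \<in> peak_saws n"
    then have saw: "d \<in> saws word_adj [] n" and ne: "d \<noteq> []" by (auto simp: peak_saws_def saws_def)
    obtain t where t: "d = [] # t" "[] \<notin> set t"
      using saw ne by (cases d) (auto simp: saws_def)
    have "length u \<le> length (last d)" if "u \<in> set d" for u
    proof -
      have "u \<in> set (butlast d) \<or> u = last d"
        using that append_butlast_last_id [OF ne]
        by (metis UnE empty_iff insert_iff list.set set_append)
      then show ?thesis using d by (auto simp: peak_saws_def)
    qed
    then show "map (embed v) d \<in> bridges G h v n"
      using saw map_embed_saws [of v d "[]" n] t ne
      by (auto simp: bridges_alt height_embed last_map)
  qed
qed

text \<open>
  The endpoint of a reversed bridge is the ancestor of \<open>v\<close> of which the whole walk consists of
  descendants. The words \<open>e k\<close> are the positions of \<open>v\<close> below its \<open>k\<close>-th ancestors.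
\<close>
lemma card_rev_bridges: "card (rev_bridges G h v n) = depth_sum (1/2) (peak_saws n)"
proof -
  define e where "e k = (SOME w. length w = k \<and> embed ((p ^^ k) v) w = v)" for k
  have e: "length (e k) = k" "embed ((p ^^ k) v) (e k) = v" for k
    using someI_ex [OF ex_embed [of k v]] by (simp_all add: e_def)
  let ?S = "{xs \<in> peak_saws n. last xs = e (length (last xs))}"
  let ?f = "\<lambda>d. rev (map (embed ((p ^^ length (last d)) v)) d)"
  have "bij_betw ?f ?S (rev_bridges G h v n)"
    unfolding bij_betw_def
  proof (intro conjI inj_onI equalityI subsetI)
    fix d d' assume d: "d \<in> ?S" "d' \<in> ?S" and eq: "?f d = ?f d'"
    have hd: "d \<noteq> []" "hd d = []" "d' \<noteq> []" "hd d' = []"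
      using d by (auto simp: peak_saws_def saws_def)
    have "last (?f d) = last (?f d')" using eq by simp
    then have a: "(p ^^ length (last d)) v = (p ^^ length (last d')) v"
      using hd by (simp add: last_rev hd_map)
    have "map (embed ((p ^^ length (last d)) v)) d = map (embed ((p ^^ length (last d)) v)) d'"
      using eq unfolding a by (simp only: rev_is_rev_conv)
    then show "d = d'" by (simp add: inj_map_eq_map inj_def)
  next
    fix ys assume "ys \<in> ?f ` ?S"
    then obtain d where d: "d \<in> peak_saws n" "last d = e (length (last d))" "ys = ?f d" by auto
    define a where "a = (p ^^ length (last d)) v"
    have saw: "d \<in> saws word_adj [] n" and ne: "d \<noteq> []" "hd d = []"
      using d by (auto simp: peak_saws_def saws_def)
    have v: "embed a (last d) = v" using e(2) [of "length (last d)"] d(2) by (simp add: a_def)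
    have ys: "ys = rev (map (embed a) d)" using d(3) by (simp add: a_def)
    have "map (embed a) d \<in> saws G a n" using saw map_embed_saws [of a d "[]"] by simp
    then have "ys \<in> saws G v n" using saws_rev [of "map (embed a) d"] ys ne v by (simp add: last_map)
    moreover have "tl ys = rev (map (embed a) (butlast d))"
      using ys ne by (metis butlast_rev map_butlast rev_rev_ident)
    moreover have "last ys = a" using ys ne by (simp add: last_rev hd_map)
    ultimately show "ys \<in> rev_bridges G h v n"
      using d(1) v height_embed [of a "last d"]
      by (auto simp: rev_bridges_alt height_embed peak_saws_def)
  next
    fix ys assume "ys \<in> rev_bridges G h v n"
    then have ys: "ys \<in> saws G v n" "\<forall>y\<in>set (tl ys). h y < h v \<and> h (last ys) \<le> h y"
      by (auto simp: rev_bridges_alt)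
    then obtain t where t: "ys = v # t" by (cases ys) (auto simp: saws_def)
    define a where "a = last ys"
    have "\<forall>y\<in>set ys. h a \<le> h y"
    proof (cases "t = []")
      case False
      then have "h a < h v" using ys(2) t by (simp add: a_def)
      then show ?thesis using ys(2) t by (auto simp: a_def)
    qed (simp add: t a_def)
    then obtain d where d: "d \<in> saws word_adj [] n" "rev ys = map (embed a) d"
      using saws_above [OF saws_rev [OF ys(1)]] by (auto simp: a_def)
    then have ne: "d \<noteq> []" using t by auto
    have "embed a (last d) = last (map (embed a) d)" using ne by (simp add: last_map)
    also have "\<dots> = v" using d(2) t by (metis last_rev list.sel(1))
    finally have v: "embed a (last d) = v" .
    then have a: "(p ^^ length (last d)) v = a" using funpow_p_embed by metis
    then have "last d = e (length (last d))" using v e(2) [of "length (last d)"] by (metis embed_eq_iff)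
    moreover have "d \<in> peak_saws n"
    proof -
      have "tl ys = rev (map (embed a) (butlast d))"
        using d(2) by (metis butlast_rev map_butlast rev_rev_ident)
      then have "\<forall>u\<in>set (butlast d). h (embed a u) < h v" using ys(2) by simp
      then have "\<forall>u\<in>set (butlast d). length u < length (last d)"
        using height_embed [of a "last d"] v by (simp add: height_embed)
      then show ?thesis using d(1) by (simp add: peak_saws_def)
    qed
    moreover have "ys = ?f d" using d(2) a by (metis rev_rev_ident)
    ultimately show "ys \<in> ?f ` ?S" by blast
  qed
  then have "card (rev_bridges G h v n) = card ?S" by (simp add: bij_betw_same_card)
  then show ?thesis using depth_sum_half_peak_saws [of e n, OF e(1)] by simp
qed

end

section \<open>The parent map defined by an end\<close>

text \<open>
  Otherwise the stretch between the point \<open>r j\<close> where the rays separate and the first point \<open>r m = s l\<close>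
  where they meet again is a cycle.
\<close>
lemma rays_eq_of_merge:
  assumes T: "is_tree T" and r: "r \<in> rays T" and s: "s \<in> rays T"
    and start: "r 0 = s 0" and merge: "\<And>i. r (a + i) = s (b + i)"
  shows "r = s"
proof (rule ccontr)
  assume "r \<noteq> s"
  have sym: "T u w \<Longrightarrow> T w u" for u w
    using T by (auto simp: is_tree_def simple_graph_def symp_def)
  have rT: "T (r i) (r (Suc i))" and sT: "T (s i) (s (Suc i))" for i
    using r s by (auto simp: rays_def)
  have r_inj: "r i = r k \<longleftrightarrow> i = k" and s_inj: "s i = s k \<longleftrightarrow> i = k" for i k
    using r s by (auto simp: rays_def inj_eq)
  define k where "k = (LEAST k. r k \<noteq> s k)"
  have "\<exists>k. r k \<noteq> s k" using \<open>r \<noteq> s\<close> by auto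
  then have k: "r k \<noteq> s k" unfolding k_def by (rule LeastI_ex)
  have below_k: "r i = s i" if "i < k" for i
    using not_less_Least [OF that [unfolded k_def]] by simp
  obtain j where j: "k = Suc j" using k start by (cases k) auto
  have rj: "r j = s j" using below_k j by simp
  define m where "m = (LEAST m. m > j \<and> (\<exists>l>j. r m = s l))"
  have "a + Suc j > j \<and> (\<exists>l>j. r (a + Suc j) = s l)"
    using merge [of "Suc j"] by (intro conjI exI [of _ "b + Suc j"]) auto
  then have "m > j \<and> (\<exists>l>j. r m = s l)" unfolding m_def by (rule LeastI)
  then obtain l where l: "m > j" "l > j" "r m = s l" by blast
  have least: "r i \<noteq> s n" if "j < i" "i < m" "n > j" for i n
    using not_less_Least [of i "\<lambda>m. m > j \<and> (\<exists>l>j. r m = s l)"] that unfolding m_def by blast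
  let ?R = "map r [j..<Suc m]" and ?S = "rev (map s [Suc j..<l])"
  have "is_cycle T (?R @ ?S)"
    unfolding is_cycle_def
  proof (intro conjI)
    have "m \<noteq> Suc j \<or> l \<noteq> Suc j" using k j l by auto
    then show "3 \<le> length (?R @ ?S)" using l by auto
    have "r i \<noteq> s n" if "i \<in> {j..m}" "n \<in> {Suc j..<l}" for i n
      using that least [of i n] rj s_inj l(3) by (cases "i = j"; cases "i = m") auto
    then show "distinct (?R @ ?S)"
      by (fastforce simp: distinct_map inj_on_def r_inj s_inj)
    have R: "successively T ?R" using rT by (auto simp: successively_conv_nth simp del: upt_Suc)
    have S: "successively T ?S"
      unfolding successively_rev using sT sym by (auto simp: successively_conv_nth)
    have "T (last ?R) (hd ?S)" if "?S \<noteq> []"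
    proof -
      have "l = Suc (l - 1)" "Suc j < l" using that by auto
      moreover from this have "last (map s [Suc j..<l]) = s (l - 1)" by (simp add: last_map)
      ultimately show ?thesis using l(1,3) sym sT [of "l - 1"] by (simp add: hd_rev)
    qed
    then show "successively T (?R @ ?S)" unfolding successively_append_iff using R S by blast
    have hd: "hd (?R @ ?S) = s j" using l rj by (simp add: hd_map del: upt_Suc)
    have "last (?R @ ?S) = s (Suc j)"
    proof (cases "l = Suc j")
      case False
      then have "Suc j < l" using l by simp
      then have "hd (map s [Suc j..<l]) = s (Suc j)" by (simp add: hd_map)
      then show ?thesis using \<open>Suc j < l\<close> by (simp add: last_rev)
    qed (use l in simp)
    with hd show "T (last (?R @ ?S)) (hd (?R @ ?S))" using sT sym by simp
  qed
  then show False using T by (auto simp: is_tree_def)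
qed

text \<open>
  Existence passes to a neighbour \<open>v\<close> of the start of a ray: prepend \<open>v\<close> to the ray, or drop the part
  before \<open>v\<close> if the ray already contains \<open>v\<close>.
\<close>
lemma end_ray_ex1:
  assumes T: "is_tree T" and \<omega>: "\<omega> \<in> ends_of T"
  shows "\<exists>!r. r \<in> \<omega> \<and> r 0 = v"
proof -
  obtain r0 where r0: "r0 \<in> rays T" and "\<omega> = ray_rel T `` {r0}"
    using \<omega> unfolding ends_of_def by (rule quotientE)
  then have \<omega>_iff: "r \<in> \<omega> \<longleftrightarrow> r \<in> rays T \<and> (\<exists>m n. \<forall>i. r0 (m + i) = r (n + i))" for r
    by (auto simp: ray_rel_def)
  have "T\<^sup>*\<^sup>* v (r0 0)" using T by (auto simp: is_tree_def)
  then have ex: "\<exists>r. r \<in> \<omega> \<and> r 0 = v"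
  proof (induction rule: converse_rtranclp_induct)
    case base
    have "r0 \<in> \<omega>" using r0 \<omega>_iff by blast
    then show ?case by blast
  next
    case (step v u)
    then obtain r m n where r: "r \<in> rays T" "r 0 = u" "\<And>i. r0 (m + i) = r (n + i)"
      using \<omega>_iff by blast
    show ?case
    proof (cases "v \<in> range r")
      case True
      then obtain k where k: "v = r k" by blast
      have "(\<lambda>i. r (k + i)) \<in> rays T" using r(1) by (auto simp: rays_def intro!: injI dest!: injD)
      moreover have "r0 ((m + k) + i) = r (k + (n + i))" for i
        using r(3) [of "k + i"] by (simp add: ac_simps)
      ultimately have "(\<lambda>i. r (k + i)) \<in> \<omega>" unfolding \<omega>_iff by blast
      then show ?thesis using k by (intro exI [of _ "\<lambda>i. r (k + i)"]) simp
    next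
      case False
      let ?s = "case_nat v r"
      have "?s \<in> rays T"
        using r(1,2) step.hyps(1) False
        by (auto simp: rays_def inj_def split: nat.split) 
      moreover have "r0 (m + i) = ?s (Suc n + i)" for i using r(3) by simp
      ultimately have "?s \<in> \<omega>" unfolding \<omega>_iff by blast
      then show ?thesis by (intro exI [of _ ?s]) simp
    qed
  qed
  have "r = s" if rs: "r \<in> \<omega>" "s \<in> \<omega>" "r 0 = s 0" for r s
  proof -
    obtain m n where r: "r \<in> rays T" "\<And>i. r0 (m + i) = r (n + i)" using rs(1) \<omega>_iff by blast
    obtain m' n' where s: "s \<in> rays T" "\<And>i. r0 (m' + i) = s (n' + i)" using rs(2) \<omega>_iff by blast
    have "r ((n + m') + i) = s ((n' + m) + i)" for i
      using r(2) [of "m' + i"] s(2) [of "m + i"] by (simp add: ac_simps)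
    then show ?thesis using rays_eq_of_merge [OF T r(1) s(1) rs(3)] by blast
  qed
  with ex show ?thesis by metis
qed

lemma predecessor_adjacent:
  assumes "is_tree T" "\<omega> \<in> ends_of T"
  shows "T v (predecessor \<omega> v)"
proof -
  define r where "r = (THE r. r \<in> \<omega> \<and> r 0 = v)"
  have r: "r \<in> \<omega>" "r 0 = v"
    using theI' [OF end_ray_ex1 [OF assms, of v]] by (simp_all add: r_def)
  have "\<omega> \<subseteq> rays T"
    using assms(2) by (auto simp: ends_of_def quotient_def ray_rel_def)
  then have "T (r 0) (r (Suc 0))" using r(1) by (auto simp: rays_def)
  then show ?thesis using r(2) by (simp add: predecessor_def r_def)
qed

text \<open>
  Along an edge that joins neither vertex to its predecessor, each end would have to be one
  level below the other; so the edges of the tree are exactly the pairs of a vertex and its predecessor.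
\<close>
lemma grandparent_tree:
  assumes T: "is_tree T" "regular_graph 3 T" and \<omega>: "\<omega> \<in> ends_of T" and h: "layer_height T \<omega> h"
  shows "\<exists>child. grandparent (predecessor \<omega>) child h (grandparent_graph T \<omega>)"
proof -
  let ?p = "predecessor \<omega>"
  have sym: "T u w \<Longrightarrow> T w u" for u w
    using T(1) by (auto simp: is_tree_def simple_graph_def symp_def)
  have up: "h (?p v) = h v - 1" and down: "T v w \<Longrightarrow> w \<noteq> ?p v \<Longrightarrow> h w = h v + 1" for v w
    using h by (auto simp: layer_height_def successors_def)
  have adj: "T v (?p v)" for v using predecessor_adjacent T(1) \<omega> .
  have T_iff: "T u w \<longleftrightarrow> w = ?p u \<or> u = ?p w" for u w
  proof
    assume uw: "T u w"
    show "w = ?p u \<or> u = ?p w"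
    proof (rule ccontr)
      assume "\<not> ?thesis"
      then show False using down [OF uw] down [OF sym [OF uw]] by simp
    qed
  qed (use adj sym in auto)
  have two: "card {w. ?p w = v} = 2" for v
  proof -
    have "{w. ?p w = v} = {w. T v w} - {?p v}"
    proof (intro set_eqI iffI)
      fix w assume "w \<in> {w. ?p w = v}"
      then have "T v w" "h w \<noteq> h (?p v)" using T_iff up [of v] up [of w] by auto
      then show "w \<in> {w. T v w} - {?p v}" by auto
    qed (use T_iff in auto)
    then show ?thesis using T(2) adj [of v] by (simp add: regular_graph_def)
  qed
  have "\<forall>v. \<exists>c :: bool \<Rightarrow> _. {w. ?p w = v} = {c True, c False} \<and> c True \<noteq> c False"
  proof
    fix v
    obtain x y where xy: "{w. ?p w = v} = {x, y}" "x \<noteq> y"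
      using two [of v] by (auto simp: card_2_iff)
    then show "\<exists>c :: bool \<Rightarrow> _. {w. ?p w = v} = {c True, c False} \<and> c True \<noteq> c False"
      by (intro exI [of _ "\<lambda>b. if b then x else y"]) simp
  qed
  then obtain child where child: "\<And>v. {w. ?p w = v} = {child v True, child v False}"
      "\<And>v. child v True \<noteq> child v False"
    by (metis (no_types))
  have "grandparent ?p child h (grandparent_graph T \<omega>)"
  proof
    show "h (?p v) = h v - 1" for v by (rule up)
    show "?p w = v \<longleftrightarrow> (\<exists>b. w = child v b)" for v w
      using child(1) [of v] unfolding ex_bool_eq by blast
    show "child v b = child v c \<longleftrightarrow> b = c" for v b c
      using child(2) [of v] by (cases b; cases c) auto
    show "grandparent_graph T \<omega> u v \<longleftrightarrow>
        v = ?p u \<or> u = ?p v \<or> v = ?p (?p u) \<or> u = ?p (?p v)" for u v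
      unfolding grandparent_graph_def T_iff by blast
  qed
  then show ?thesis by blast
qed

section \<open>Limits and roots of the polynomials\<close>

text \<open>
  Bounds at every \<open>x\<close> near \<open>\<rho>\<close>, with constants that may depend on \<open>x\<close>, are enough; the factor \<open>n + 1\<close>
  makes room for the convolution in the upper bound for self-avoiding walks.
\<close>
lemma root_tendsto:
  fixes a :: "nat \<Rightarrow> real"
  assumes \<rho>: "0 < \<rho>" "\<rho> < b"
    and upper: "\<And>x. 0 < x \<Longrightarrow> x < \<rho> \<Longrightarrow> \<exists>K>0. \<forall>n. a n \<le> K * real (n + 1) * (1 / x) ^ n"
    and lower: "\<And>x. \<rho> < x \<Longrightarrow> x < b \<Longrightarrow> \<exists>c>0. \<exists>N. \<forall>n\<ge>N. c * (1 / x) ^ n \<le> a n"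
  shows "(\<lambda>n. root n (a n)) \<longlonglongrightarrow> 1 / \<rho>"
proof (rule order_tendstoI)
  fix t assume t: "t < 1 / \<rho>"
  \<comment> \<open>A bound \<open>t\<close> below \<open>1 / b\<close> is raised, so that \<open>1 / t'\<close> stays in the range of the lower bound.\<close>
  define t' where "t' = max t (1 / b)"
  have t': "0 < t'" "t' < 1 / \<rho>" "1 / b \<le> t'" "t \<le> t'"
    using t \<rho> by (auto simp: t'_def frac_less2 less_max_iff_disj)
  have "\<rho> < 1 / t'" "1 / t' \<le> b" using t' \<rho> by (auto simp: field_simps)
  then obtain x where x: "\<rho> < x" "x < 1 / t'" "x < b" using dense [of \<rho> "1 / t'"] by auto
  then obtain c N where c: "c > 0" "\<And>n. n \<ge> N \<Longrightarrow> c * (1 / x) ^ n \<le> a n"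
    using lower by blast
  have "x > 0" using x \<rho> by simp
  have "(\<lambda>n. root n c * (1 / x)) \<longlonglongrightarrow> 1 * (1 / x)"
    by (intro tendsto_intros LIMSEQ_root_const c)
  moreover have "t' < 1 / x" using x(2) t'(1) \<open>x > 0\<close> by (simp add: field_simps)
  then have "t < 1 * (1 / x)" using t'(4) by simp
  ultimately have "\<forall>\<^sub>F n in sequentially. t < root n c * (1 / x)" by (rule order_tendstoD)
  then show "\<forall>\<^sub>F n in sequentially. t < root n (a n)"
    using eventually_ge_at_top [of "max N 1"]
  proof eventually_elim
    case (elim n)
    have "root n c * (1 / x) = root n (c * (1 / x) ^ n)"
      using elim \<open>x > 0\<close> by (simp add: real_root_mult real_root_power_cancel del: power_one_over)
    also have "\<dots> \<le> root n (a n)" using c(2) elim by simp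
    finally show ?case using elim by simp
  qed
next
  fix t assume t: "1 / \<rho> < t"
  have "0 < t" using t \<rho> by (meson divide_pos_pos less_trans zero_less_one)
  then have "1 / t < \<rho>" using t \<rho> by (simp add: field_simps)
  then obtain x where x: "1 / t < x" "x < \<rho>" using dense by blast
  have "0 < x" using x \<open>0 < t\<close> by (meson divide_pos_pos less_trans zero_less_one)
  then obtain K where K: "K > 0" "\<And>n. a n \<le> K * real (n + 1) * (1 / x) ^ n"
    using upper x by blast
  have "(\<lambda>n. root n (2 * K) * root n n * (1 / x)) \<longlonglongrightarrow> 1 * 1 * (1 / x)"
    using K by (intro tendsto_intros LIMSEQ_root_const LIMSEQ_root) simp
  moreover have "1 * 1 * (1 / x) < t" using x \<open>0 < x\<close> \<open>0 < t\<close> by (simp add: field_simps)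
  ultimately have "\<forall>\<^sub>F n in sequentially. root n (2 * K) * root n n * (1 / x) < t"
    by (rule order_tendstoD)
  then show "\<forall>\<^sub>F n in sequentially. root n (a n) < t"
    using eventually_ge_at_top [of 1]
  proof eventually_elim
    case (elim n)
    have "K * real (n + 1) * (1 / x) ^ n \<le> K * (2 * real n) * (1 / x) ^ n"
      using K elim \<open>0 < x\<close> by (intro mult_left_mono mult_right_mono) auto
    then have "a n \<le> 2 * K * real n * (1 / x) ^ n"
      using K(2) [of n] by (simp add: mult_ac)
    then have "root n (a n) \<le> root n (2 * K * real n * (1 / x) ^ n)" using elim by simp
    also have "\<dots> = root n (2 * K) * root n n * (1 / x)"
      using elim \<open>0 < x\<close> by (simp add: real_root_mult real_root_power_cancel del: power_one_over)
    finally show ?case using elim by simp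
  qed
qed

lemma smallest_pos_root_decreasing:
  fixes q :: "real poly"
  assumes l: "0 < l" "l < u" "u < b" "0 < poly q l" "poly q u < 0"
    and deriv: "\<And>x. 0 < x \<Longrightarrow> x < b \<Longrightarrow> poly (pderiv q) x < 0"
  defines "\<rho> \<equiv> smallest_pos_root q"
  shows "l < \<rho>" "\<rho> < u" "\<And>x. 0 < x \<Longrightarrow> x < \<rho> \<Longrightarrow> 0 < poly q x"
    "\<And>x. \<rho> < x \<Longrightarrow> x < b \<Longrightarrow> poly q x < 0"
proof -
  have decr: "poly q y < poly q x" if "0 < x" "x < y" "y < b" for x y
    using that by (intro DERIV_neg_imp_decreasing [OF \<open>x < y\<close>])
      (metis poly_DERIV deriv order_less_le_trans order_le_less_trans)
  have "\<exists>r\<ge>l. r \<le> u \<and> poly q r = 0"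
    using l by (intro IVT2') (auto intro!: continuous_intros)
  then obtain r where r: "l \<le> r" "r \<le> u" "poly q r = 0" by blast
  then have rlu: "l < r" "r < u" using l by (auto simp: less_le)
  have "\<rho> = r"
    unfolding \<rho>_def smallest_pos_root_def
  proof (rule Least_equality)
    show "0 < r \<and> poly q r = 0" using r l by simp
    fix y assume y: "0 < y \<and> poly q y = 0"
    then show "r \<le> y" using decr [of y r] r rlu l by force
  qed
  then show "l < \<rho>" "\<rho> < u" using rlu by auto
  show "0 < poly q x" if "0 < x" "x < \<rho>" for x
    using decr [of x r] that \<open>\<rho> = r\<close> r rlu l by simp
  show "poly q x < 0" if "\<rho> < x" "x < b" for x
    using decr [of r x] that \<open>\<rho> = r\<close> r rlu l by simp
qed

lemma renewal_full:
  fixes x :: real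
  assumes "x < 1/2"
  shows "1 - renewal x 1 (x / (1 - 2 * x)) = poly [:1, -8, 10, -8, 8:] x / (1 - 2 * x)"
  using assms by (simp add: renewal_def divide_simps) (simp add: algebra_simps power2_eq_square)

lemma renewal_half:
  fixes x :: real
  assumes "x < 1/2"
  shows "1 - renewal x (1/2) (x / (1 - 2 * x)) = poly [:1, -4, 3, -1, 1:] x / (1 - 2 * x)"
  using assms by (simp add: renewal_def divide_simps power2_eq_square) (simp add: algebra_simps power2_eq_square)

lemma pderiv_full_neg:
  fixes x :: real
  assumes "x < 1/2"
  shows "poly (pderiv [:1, -8, 10, -8, 8:]) x < 0"
proof -
  \<comment> \<open>The derivative vanishes at \<open>1/2\<close> and the cofactor is a positive quadratic.\<close>
  have "poly (pderiv [:1, -8, 10, -8, 8:]) x = (2 * x - 1) * ((4 * x - 1/2)^2 + 31/4)"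
    by (simp add: pderiv_pCons algebra_simps power2_eq_square)
  moreover have "(4 * x - 1/2)^2 + 31/4 > 0" by (intro add_nonneg_pos) auto
  ultimately show ?thesis using assms by (simp add: mult_neg_pos)
qed

lemma pderiv_half_neg:
  fixes x :: real
  assumes "0 < x" "x < 1/2"
  shows "poly (pderiv [:1, -4, 3, -1, 1:]) x < 0"
proof -
  have "poly (pderiv [:1, -4, 3, -1, 1:]) x = (6 * x - 3) - (1 - 4 * (x * x * x)) - 3 * (x * x)"
    by (simp add: pderiv_pCons algebra_simps)
  moreover have "x * x * x \<le> (1/2) * (1/2) * (1/2)"
    using assms by (intro mult_mono) auto
  moreover have "x * x > 0" using assms by simp
  ultimately show ?thesis using assms by linarith
qed

lemma smallest_root_full:
  defines "q \<equiv> [:1, -8, 10, -8, 8 :: real:]"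
  shows "1/6.649935 < smallest_pos_root q" "smallest_pos_root q < 1/6.649925"
    "\<And>x. 0 < x \<Longrightarrow> x < smallest_pos_root q \<Longrightarrow> 0 < poly q x"
    "\<And>x. smallest_pos_root q < x \<Longrightarrow> x < 1/2 \<Longrightarrow> poly q x < 0"
  unfolding q_def
  by (rule smallest_pos_root_decreasing [where l = "1/6.649935" and u = "1/6.649925" and b = "1/2"];
      simp add: pderiv_full_neg del: pderiv_pCons; fail)+

lemma smallest_root_half:
  defines "q \<equiv> [:1, -4, 3, -1, 1 :: real:]"
  shows "1/3.103805 < smallest_pos_root q" "smallest_pos_root q < 1/3.103795"
    "\<And>x. 0 < x \<Longrightarrow> x < smallest_pos_root q \<Longrightarrow> 0 < poly q x"
    "\<And>x. smallest_pos_root q < x \<Longrightarrow> x < 1/2 \<Longrightarrow> poly q x < 0"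
  unfolding q_def
  by (rule smallest_pos_root_decreasing [where l = "1/3.103805" and u = "1/3.103795" and b = "1/2"];
      simp add: pderiv_half_neg del: pderiv_pCons; fail)+

section \<open>The growth constants\<close>

lemma depth_sum_1 [simp]: "depth_sum 1 X = card X"
  by (simp add: depth_sum_def)

context grandparent
begin

text \<open>
  One upper bound, for all walks, and one lower bound, for bridges, give both limits at once.
\<close>
lemma saws_bridges_limit:
  defines "\<rho> \<equiv> smallest_pos_root [:1, -8, 10, -8, 8:]"
  shows "(\<lambda>n. root n (card (bridges G h v n))) \<longlonglongrightarrow> 1 / \<rho>"
    and "(\<lambda>n. root n (card (saws G v n))) \<longlonglongrightarrow> 1 / \<rho>"
proof -
  note \<rho> = smallest_root_full [folded \<rho>_def]
  have \<rho>0: "0 < \<rho>" "\<rho> < 1/2" using \<rho>(1,2) by auto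
  have le: "card (bridges G h v n) \<le> card (saws G v n)" for n
    by (rule card_mono) (auto simp: bridges_def)
  have upper: "\<exists>K>0. \<forall>n. real (card (saws G v n)) \<le> K * real (n + 1) * (1 / x) ^ n"
    if x: "0 < x" "x < \<rho>" for x
  proof -
    have x2: "x < 1/2" using x \<rho>0 by simp
    have "0 < poly [:1, -8, 10, -8, 8:] x / (1 - 2 * x)"
      using \<rho>(3) [OF x] x2 by (intro divide_pos_pos) auto
    then have "renewal x 1 (x / (1 - 2 * x)) < 1" using renewal_full [OF x2] by linarith
    then obtain K where K: "K > 0"
        "\<And>n. (\<Sum>xs\<in>saws word_adj [] n. 1 ^ length (last xs)) \<le> K * (1 / x) ^ n"
      using weighted_count_le [OF x(1) x2] by (metis half_gt_zero zero_less_one)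
    have "real (card (saws G v n)) \<le> K^2 * real (n + 1) * (1 / x) ^ n" for n
    proof -
      have "real (card (saws G v n))
          \<le> (\<Sum>i\<le>n. real (card (saws word_adj [] i)) * real (card (saws word_adj [] (n - i))))"
        using of_nat_mono [OF card_saws_le [of v n], where 'a = real] by simp
      also have "\<dots> \<le> (\<Sum>i\<le>n. (K * (1 / x) ^ i) * (K * (1 / x) ^ (n - i)))"
        using K x by (intro sum_mono mult_mono) auto
      also have "\<dots> = (\<Sum>i\<le>n. K^2 * (1 / x) ^ n)"
      proof (rule sum.cong [OF refl])
        fix i assume "i \<in> {..n}"
        then have "(1 / x) ^ i * (1 / x) ^ (n - i) = (1 / x) ^ n"
          by (simp add: power_add [symmetric] del: power_one_over)
        then show "(K * (1 / x) ^ i) * (K * (1 / x) ^ (n - i)) = K^2 * (1 / x) ^ n"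
          by (simp add: power2_eq_square mult_ac)
      qed
      finally show ?thesis by (simp add: mult_ac)
    qed
    then show ?thesis using K(1) by (intro exI [of _ "K^2"]) auto
  qed
  have lower: "\<exists>c>0. \<exists>N. \<forall>n\<ge>N. c * (1 / x) ^ n \<le> real (card (bridges G h v n))"
    if x: "\<rho> < x" "x < 1/2" for x
  proof -
    have "poly [:1, -8, 10, -8, 8:] x / (1 - 2 * x) < 0"
      using \<rho>(4) [OF x] x by (intro divide_neg_pos) auto
    moreover have x0: "0 < x" using x(1) \<rho>0 by simp
    ultimately have "1 < renewal x 1 (x / (1 - 2 * x))" using renewal_full [OF x(2)] by linarith
    then obtain c N where c: "c > 0" "\<And>n. n \<ge> N \<Longrightarrow> c * (1 / x) ^ n \<le> depth_sum 1 (peak_saws n)"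
      using peak_saws_ge [of x 1] x(2) x0 by auto
    have "depth_sum 1 (peak_saws n) \<le> real (card (bridges G h v n))" for n
      using card_bridges_ge [of n v] by simp
    then show ?thesis using c order_trans by blast
  qed
  show "(\<lambda>n. root n (card (bridges G h v n))) \<longlonglongrightarrow> 1 / \<rho>"
  proof (rule root_tendsto [OF \<rho>0 _ lower])
    fix x assume "0 < x" "x < \<rho>"
    with upper obtain K where K: "K > 0" "\<And>n. real (card (saws G v n)) \<le> K * real (n + 1) * (1 / x) ^ n"
      by blast
    then show "\<exists>K>0. \<forall>n. real (card (bridges G h v n)) \<le> K * real (n + 1) * (1 / x) ^ n"
      using le by (meson of_nat_mono order_trans)
  qed
  show "(\<lambda>n. root n (card (saws G v n))) \<longlonglongrightarrow> 1 / \<rho>"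
  proof (rule root_tendsto [OF \<rho>0 upper])
    fix x assume "\<rho> < x" "x < 1/2"
    with lower obtain c N where "c > 0" "\<And>n. n \<ge> N \<Longrightarrow> c * (1 / x) ^ n \<le> real (card (bridges G h v n))"
      by blast
    then show "\<exists>c>0. \<exists>N. \<forall>n\<ge>N. c * (1 / x) ^ n \<le> real (card (saws G v n))"
      using le by (meson of_nat_mono order_trans)
  qed
qed

lemma rev_bridges_limit:
  defines "\<rho> \<equiv> smallest_pos_root [:1, -4, 3, -1, 1:]"
  shows "(\<lambda>n. root n (card (rev_bridges G h v n))) \<longlonglongrightarrow> 1 / \<rho>"
proof (rule root_tendsto [where b = "1/2"])
  note \<rho> = smallest_root_half [folded \<rho>_def]
  show \<rho>0: "0 < \<rho>" "\<rho> < 1/2" using \<rho>(1,2) by auto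
  show "\<exists>K>0. \<forall>n. real (card (rev_bridges G h v n)) \<le> K * real (n + 1) * (1 / x) ^ n"
    if x: "0 < x" "x < \<rho>" for x
  proof -
    have x2: "x < 1/2" using x \<rho>0 by simp
    have "0 < poly [:1, -4, 3, -1, 1:] x / (1 - 2 * x)"
      using \<rho>(3) [OF x] x2 by (intro divide_pos_pos) auto
    then have "renewal x (1/2) (x / (1 - 2 * x)) < 1" using renewal_half [OF x2] by linarith
    then obtain K where K: "K > 0"
        "\<And>n. (\<Sum>xs\<in>saws word_adj [] n. (1/2) ^ length (last xs)) \<le> K * (1 / x) ^ n"
      using weighted_count_le [OF x(1) x2] by (metis half_gt_zero zero_less_one)
    have "real (card (rev_bridges G h v n)) \<le> K * real (n + 1) * (1 / x) ^ n" for n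
    proof -
      have "real (card (rev_bridges G h v n)) \<le> (\<Sum>xs\<in>saws word_adj [] n. (1/2) ^ length (last xs))"
        unfolding card_rev_bridges depth_sum_def by (intro sum_mono2) (auto simp: peak_saws_def)
      also have "\<dots> \<le> K * (1 / x) ^ n" by (rule K)
      also have "\<dots> \<le> K * real (n + 1) * (1 / x) ^ n"
        using K(1) x by (intro mult_right_mono) auto
      finally show ?thesis .
    qed
    then show ?thesis using K(1) by blast
  qed
  show "\<exists>c>0. \<exists>N. \<forall>n\<ge>N. c * (1 / x) ^ n \<le> real (card (rev_bridges G h v n))"
    if x: "\<rho> < x" "x < 1/2" for x
  proof -
    have "poly [:1, -4, 3, -1, 1:] x / (1 - 2 * x) < 0"
      using \<rho>(4) [OF x] x by (intro divide_neg_pos) auto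
    moreover have x0: "0 < x" using x(1) \<rho>0 by simp
    ultimately have "1 < renewal x (1/2) (x / (1 - 2 * x))" using renewal_half [OF x(2)] by linarith
    then obtain c N where "c > 0" "\<And>n. n \<ge> N \<Longrightarrow> c * (1 / x) ^ n \<le> depth_sum (1/2) (peak_saws n)"
      using peak_saws_ge [of x "1/2"] x(2) x0 by auto
    then show ?thesis unfolding card_rev_bridges by blast
  qed
qed

end

theorem mainTheorem2:
  fixes T :: "'v \<Rightarrow> 'v \<Rightarrow> bool"
    and \<omega> :: "(nat \<Rightarrow> 'v) set"
    and h :: "'v \<Rightarrow> int"
    and GP :: "'v \<Rightarrow> 'v \<Rightarrow> bool"
    and v :: 'v
    and \<rho> \<rho>' :: real
  assumes "is_tree T" and "regular_graph 3 T"
    and "\<omega> \<in> ends_of T"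
    and "layer_height T \<omega> h"
    and "GP = grandparent_graph T \<omega>"
    and "\<rho> = smallest_pos_root [:1, -8, 10, -8, 8:]"
    and "\<rho>' = smallest_pos_root [:1, -4, 3, -1, 1:]"
  shows "convergent (\<lambda>n. root n (real (card (bridges GP h v n))))
       \<and> convergent (\<lambda>n. root n (real (card (rev_bridges GP h v n))))
       \<and> convergent (\<lambda>n. root n (real (card (saws GP v n))))
       \<and> bridge_constant GP h v = 1 / \<rho>
       \<and> rev_bridge_constant GP h v = 1 / \<rho>'
       \<and> connective_constant GP v = max (bridge_constant GP h v) (rev_bridge_constant GP h v)
       \<and> connective_constant GP v = 1 / \<rho>
       \<and> \<bar>1 / \<rho> - 6.64993\<bar> < 0.000005
       \<and> \<bar>1 / \<rho>' - 3.10380\<bar> < 0.000005"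
proof -
  obtain child where "grandparent (predecessor \<omega>) child h GP"
    using grandparent_tree assms(1-5) by blast
  then interpret grandparent "predecessor \<omega>" child h GP .
  have b: "(\<lambda>n. root n (real (card (bridges GP h v n)))) \<longlonglongrightarrow> 1 / \<rho>"
    and s: "(\<lambda>n. root n (real (card (saws GP v n)))) \<longlonglongrightarrow> 1 / \<rho>"
    and r: "(\<lambda>n. root n (real (card (rev_bridges GP h v n)))) \<longlonglongrightarrow> 1 / \<rho>'"
    unfolding assms(6,7) by (rule saws_bridges_limit rev_bridges_limit)+
  have constants: "bridge_constant GP h v = 1 / \<rho>" "connective_constant GP v = 1 / \<rho>"
      "rev_bridge_constant GP h v = 1 / \<rho>'"
    unfolding bridge_constant_def connective_constant_def rev_bridge_constant_def growth_rate_def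
    using b s r by (auto intro: limI)
  have "1/6.649935 < \<rho>" "\<rho> < 1/6.649925"
    unfolding assms(6) by (rule smallest_root_full(1,2))+
  then have num: "6.649925 < 1 / \<rho>" "1 / \<rho> < 6.649935" by (simp_all add: field_simps)
  have "1/3.103805 < \<rho>'" "\<rho>' < 1/3.103795"
    unfolding assms(7) by (rule smallest_root_half(1,2))+
  then have num': "3.103795 < 1 / \<rho>'" "1 / \<rho>' < 3.103805" by (simp_all add: field_simps)
  have "max (1 / \<rho>) (1 / \<rho>') = 1 / \<rho>" using num num' by simp
  moreover have "\<bar>1 / \<rho> - 6.64993\<bar> < 0.000005"
    using num unfolding abs_less_iff by auto
  moreover have "\<bar>1 / \<rho>' - 3.10380\<bar> < 0.000005"
    using num' unfolding abs_less_iff by auto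
  ultimately show ?thesis
    using b s r constants by (auto intro: convergentI)
qed

end
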